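(* Let $m\ge 2$, and let $\xi_0$ be the design with weight $\frac1{m-1}$ on each of the pairs $(1,2),(2,3),\dots,(m-1,m)$ and weight $0$ on all other pairs. The saturated designs for the Bradley--Terry paired comparison model with $m$ alternatives that are locally $D$-optimal for at least one $\beta\in\mathbb{R}^{m-1}$ are exactly the designs $\xi_0^\sigma$, $\sigma\in S_m$, i.e. the designs with equal weights $\frac{1}{m-1}$ on the edges of a path on $\{1,\dots,m\}$. Their regions of optimality form the $S_m$-orbit of the region of optimality of $\xi_0$, that is, $R(\xi_0^\sigma)=Q_\sigma^{-T}R(\xi_0)$ for every $\sigma\in S_m$. Moreover, for every $\sigma\in S_m$, the region of optimality of the path design $\xi_0^\sigma$, supported on the edges $\{\sigma(1),\sigma(2)\},\{\sigma(2),\sigma(3)\},\dots,\{\sigma(m-1),\sigma(m)\}$, is $$R(\xi_0^\sigma)=\Big\{\beta\in\mathbb{R}^{m-1}:\ \lambda_{\sigma(i)\sigma(j)}(\beta)\sum_{k=i}^{j-1}\frac{1}{\lambda_{\sigma(k)\sigma(k+1)}(\beta)}\le 1\ \text{ for all } 1\le i<j\le m\Big\}.$$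
   Context: Bradley--Terry model with $m\ge 2$ alternatives. The parameters are $\beta=(\beta_1,\dots,\beta_{m-1})^T\in\mathbb{R}^{m-1}$, with the convention $\beta_m=0$. Let $e_1,\dots,e_{m-1}$ be the standard unit vectors of $\mathbb{R}^{m-1}$ and put $e_m=0$. The regression vectors are $f(i,j)=e_i-e_j$ for $i,j\in\{1,\dots,m\}$. The intensity is $\lambda_{ij}=\lambda_{ij}(\beta)=\dfrac{e^{\beta_i-\beta_j}}{(1+e^{\beta_i-\beta_j})^2}$, which satisfies $\lambda_{ij}=\lambda_{ji}$. A design $\xi$ is an assignment of a real weight $w_{ij}\ge 0$ to each pair $(i,j)$ with $1\le i<j\le m$ such that $\sum_{i<j}w_{ij}=1$. The support of $\xi$ is the set of pairs with $w_{ij}>0$. The information matrix is $M(\xi,\beta)=\sum_{i<j}w_{ij}\lambda_{ij}f(i,j)f(i,j)^T\in\mathbb{R}^{(m-1)\times(m-1)}$. A design $\xi^*$ is locally $D$-optimal for $\beta$ if $\log\det M(\xi^*,\beta)\ge\log\det M(\xi,\beta)$ for all designs $\xi$ (with $\log 0=-\infty$). A design is saturated if its support has exactly $m-1$ elements. The region of optimality of a design $\xi$ is $R(\xi)=\{\beta\in\mathbb{R}^{m-1}:\xi\text{ is locally }D\text{-optimal for }\beta\}$. The symmetric group $S_m$ acts on pairs by acting on both entries (and reordering them increasingly if necessary), and on designs by $(\xi^\sigma)_{(i,j)}=\xi_{\sigma^{-1}(i,j)}$. For $\sigma\in S_m$, $Q_\sigma$ is the invertible $(m-1)\times(m-1)$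 matrix determined by $f(\sigma(i),\sigma(j))=Q_\sigma f(i,j)$ for all $i,j$; $Q_\sigma^{-T}$ is the inverse transpose. A path on $\{1,\dots,m\}$ is a tree with this vertex set in which every vertex is connected to at most two other vertices. *)

theory Defs
  imports
    Complex_Main
    "HOL-Library.Extended_Real"
    "HOL-Combinatorics.Permutations"
    "Jordan_Normal_Form.Determinant"
    "Jordan_Normal_Form.Gauss_Jordan_Elimination"
begin

text \<open>
  The alternatives are the numbers \<open>1, \<dots>, m\<close>. Vectors and matrices are indexed from 0, so the
  coordinate that belongs to alternative \<open>i < m\<close> has index \<open>i - 1\<close>.
\<close>

definition param :: "nat \<Rightarrow> real vec \<Rightarrow> nat \<Rightarrow> real" where
  "param m \<beta> i = (if i = m then 0 else \<beta> $ (i - 1))"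

definition unit_of :: "nat \<Rightarrow> nat \<Rightarrow> real vec" where
  "unit_of m i = (if i = m then 0\<^sub>v (m - 1) else unit_vec (m - 1) (i - 1))"

definition regr :: "nat \<Rightarrow> nat \<Rightarrow> nat \<Rightarrow> real vec" where
  "regr m i j = unit_of m i - unit_of m j"

definition intensity :: "nat \<Rightarrow> real vec \<Rightarrow> nat \<Rightarrow> nat \<Rightarrow> real" where
  "intensity m \<beta> i j =
     exp (param m \<beta> i - param m \<beta> j) / (1 + exp (param m \<beta> i - param m \<beta> j))\<^sup>2"


definition pairs :: "nat \<Rightarrow> (nat \<times> nat) set" where
  "pairs m = {(i, j). 1 \<le> i \<and> i < j \<and> j \<le> m}"

text \<open>
  Designs are extended by 0 to arguments that are not pairs \<open>i < j\<close> of alternatives, so that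
  equality of designs is equality of functions.
\<close>

definition design :: "nat \<Rightarrow> (nat \<times> nat \<Rightarrow> real) \<Rightarrow> bool" where
  "design m \<xi> \<longleftrightarrow>
     (\<forall>p\<in>pairs m. 0 \<le> \<xi> p) \<and> (\<Sum>p\<in>pairs m. \<xi> p) = 1 \<and> (\<forall>p. p \<notin> pairs m \<longrightarrow> \<xi> p = 0)"

definition supp :: "nat \<Rightarrow> (nat \<times> nat \<Rightarrow> real) \<Rightarrow> (nat \<times> nat) set" where
  "supp m \<xi> = {p \<in> pairs m. 0 < \<xi> p}"

definition saturated :: "nat \<Rightarrow> (nat \<times> nat \<Rightarrow> real) \<Rightarrow> bool" where
  "saturated m \<xi> \<longleftrightarrow> card (supp m \<xi>) = m - 1"


definition outer_self :: "real vec \<Rightarrow> real mat" where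
  "outer_self v = mat (dim_vec v) (dim_vec v) (\<lambda>(a, b). v $ a * v $ b)"

text \<open>
  The sum of matrices is written entrywise, as the type of matrices of all dimensions is not an
  additive monoid.
\<close>

definition info_mat :: "nat \<Rightarrow> (nat \<times> nat \<Rightarrow> real) \<Rightarrow> real vec \<Rightarrow> real mat" where
  "info_mat m \<xi> \<beta> = mat (m - 1) (m - 1) (\<lambda>(a, b).
     \<Sum>(i, j)\<in>pairs m. ((\<xi> (i, j) * intensity m \<beta> i j) \<cdot>\<^sub>m outer_self (regr m i j)) $$ (a, b))"

text \<open>Determinants of information matrices are nonnegative; only the value at 0 is a convention.\<close>

definition log_ext :: "real \<Rightarrow> ereal" where
  "log_ext x = (if 0 < x then ereal (ln x) else - \<infinity>)"

definition locally_D_optimal :: "nat \<Rightarrow> (nat \<times> nat \<Rightarrow> real) \<Rightarrow> real vec \<Rightarrow> bool" where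
  "locally_D_optimal m \<xi> \<beta> \<longleftrightarrow> design m \<xi> \<and>
     (\<forall>\<eta>. design m \<eta> \<longrightarrow> log_ext (det (info_mat m \<eta> \<beta>)) \<le> log_ext (det (info_mat m \<xi> \<beta>)))"

definition region :: "nat \<Rightarrow> (nat \<times> nat \<Rightarrow> real) \<Rightarrow> real vec set" where
  "region m \<xi> = {\<beta> \<in> carrier_vec (m - 1). locally_D_optimal m \<xi> \<beta>}"


definition act_pair :: "(nat \<Rightarrow> nat) \<Rightarrow> nat \<times> nat \<Rightarrow> nat \<times> nat" where
  "act_pair \<sigma> = (\<lambda>(i, j). (min (\<sigma> i) (\<sigma> j), max (\<sigma> i) (\<sigma> j)))"

definition act_design :: "nat \<Rightarrow> (nat \<Rightarrow> nat) \<Rightarrow> (nat \<times> nat \<Rightarrow> real) \<Rightarrow> (nat \<times> nat \<Rightarrow> real)" where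
  "act_design m \<sigma> \<xi> = (\<lambda>p. if p \<in> pairs m then \<xi> (act_pair (inv_into UNIV \<sigma>) p) else 0)"

text \<open>
  \<open>Q_mat m \<sigma>\<close> is well defined and invertible for every permutation \<open>\<sigma>\<close> of the alternatives, see
  the two lemmas at the end.
\<close>

definition Q_mat :: "nat \<Rightarrow> (nat \<Rightarrow> nat) \<Rightarrow> real mat" where
  "Q_mat m \<sigma> = (THE Q. Q \<in> carrier_mat (m - 1) (m - 1) \<and>
     (\<forall>i\<in>{1..m}. \<forall>j\<in>{1..m}. regr m (\<sigma> i) (\<sigma> j) = Q *\<^sub>v regr m i j))"

definition inv_transpose :: "real mat \<Rightarrow> real mat" where
  "inv_transpose A = transpose_mat (the (mat_inverse A))"


definition path_design0 :: "nat \<Rightarrow> nat \<times> nat \<Rightarrow> real" where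
  "path_design0 m = (\<lambda>(i, j). if 1 \<le> i \<and> i < m \<and> j = i + 1 then 1 / (real m - 1) else 0)"

definition adj :: "(nat \<times> nat) set \<Rightarrow> nat \<Rightarrow> nat \<Rightarrow> bool" where
  "adj E u v \<longleftrightarrow> (u, v) \<in> E \<or> (v, u) \<in> E"

definition cycle_in :: "(nat \<times> nat) set \<Rightarrow> nat list \<Rightarrow> bool" where
  "cycle_in E vs \<longleftrightarrow> 3 \<le> length vs \<and> distinct vs \<and>
     (\<forall>k<length vs. adj E (vs ! k) (vs ! ((k + 1) mod length vs)))"

definition tree_on :: "nat \<Rightarrow> (nat \<times> nat) set \<Rightarrow> bool" where
  "tree_on m E \<longleftrightarrow> E \<subseteq> pairs m \<and>
     (\<forall>u\<in>{1..m}. \<forall>v\<in>{1..m}. (adj E)\<^sup>*\<^sup>* u v) \<and> (\<nexists>vs. cycle_in E vs)"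

definition path_on :: "nat \<Rightarrow> (nat \<times> nat) set \<Rightarrow> bool" where
  "path_on m E \<longleftrightarrow> tree_on m E \<and> (\<forall>u\<in>{1..m}. card {v. adj E u v} \<le> 2)"

definition uniform_on :: "nat \<Rightarrow> (nat \<times> nat) set \<Rightarrow> nat \<times> nat \<Rightarrow> real" where
  "uniform_on m E = (\<lambda>p. if p \<in> E then 1 / (real m - 1) else 0)"


lemma mult_unit_vec_col:
  fixes A :: "real mat"
  assumes "A \<in> carrier_mat n n" "k < n"
  shows "A *\<^sub>v unit_vec n k = col A k"
  using assms by (intro eq_vecI) auto

context
  notes One_nat_def [simp del]
begin

lemma unit_of_carrier [simp]: "unit_of m i \<in> carrier_vec (m - 1)"
  by (simp add: unit_of_def)

lemma regr_carrier [simp]: "regr m i j \<in> carrier_vec (m - 1)"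
  by (simp add: regr_def)

lemma regr_unit: "1 \<le> i \<Longrightarrow> i < m \<Longrightarrow> regr m i m = unit_vec (m - 1) (i - 1)"
  by (auto simp: regr_def unit_of_def)

lemma regr_diff: "regr m i j = regr m i k - regr m j k"
  by (rule eq_vecI) (auto simp: regr_def carrier_vecD[OF unit_of_carrier])

lemma Q_mat_unique:
  assumes s: "\<sigma> permutes {1..m}"
  shows "\<exists>!Q. Q \<in> carrier_mat (m - 1) (m - 1) \<and>
     (\<forall>i\<in>{1..m}. \<forall>j\<in>{1..m}. regr m (\<sigma> i) (\<sigma> j) = Q *\<^sub>v regr m i j)"
proof (rule ex_ex1I)
  define Q where "Q = mat_of_cols (m - 1) (map (\<lambda>k. regr m (\<sigma> (k + 1)) (\<sigma> m)) [0..<m - 1])"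
  have Q: "Q \<in> carrier_mat (m - 1) (m - 1)"
    by (auto simp: Q_def mat_of_cols_def)
  have m: "regr m (\<sigma> i) (\<sigma> m) = Q *\<^sub>v regr m i m" if "i \<in> {1..m}" for i
  proof (cases "i = m")
    case True
    then show ?thesis using Q
      by (intro eq_vecI) (auto simp: regr_def carrier_vecD[OF unit_of_carrier] scalar_prod_def)
  next
    case False
    with that have "Q *\<^sub>v regr m i m = col Q (i - 1)"
      using mult_unit_vec_col[OF Q, of "i - 1"] by (auto simp: regr_unit)
    also have "\<dots> = regr m (\<sigma> i) (\<sigma> m)"
      using that False unfolding Q_def by (subst col_mat_of_cols) auto
    finally show ?thesis by simp
  qed
  have "regr m (\<sigma> i) (\<sigma> j) = Q *\<^sub>v regr m i j" if "i \<in> {1..m}" "j \<in> {1..m}" for i j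
  proof -
    have "Q *\<^sub>v regr m i j = Q *\<^sub>v (regr m i m - regr m j m)"
      by (rule arg_cong[OF regr_diff])
    also have "\<dots> = Q *\<^sub>v regr m i m - Q *\<^sub>v regr m j m"
      using Q by (intro mult_minus_distrib_mat_vec) auto
    also have "\<dots> = regr m (\<sigma> i) (\<sigma> j)"
      unfolding m[OF that(1), symmetric] m[OF that(2), symmetric] by (rule regr_diff[symmetric])
    finally show ?thesis by simp
  qed
  with Q show "\<exists>Q. Q \<in> carrier_mat (m - 1) (m - 1) \<and>
     (\<forall>i\<in>{1..m}. \<forall>j\<in>{1..m}. regr m (\<sigma> i) (\<sigma> j) = Q *\<^sub>v regr m i j)" by blast
next
  fix A B
  assume A: "A \<in> carrier_mat (m - 1) (m - 1) \<and>
     (\<forall>i\<in>{1..m}. \<forall>j\<in>{1..m}. regr m (\<sigma> i) (\<sigma> j) = A *\<^sub>v regr m i j)"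
    and B: "B \<in> carrier_mat (m - 1) (m - 1) \<and>
     (\<forall>i\<in>{1..m}. \<forall>j\<in>{1..m}. regr m (\<sigma> i) (\<sigma> j) = B *\<^sub>v regr m i j)"
  have "col A k = col B k" if k: "k < m - 1" for k
  proof -
    have e: "regr m (k + 1) m = unit_vec (m - 1) k"
      using k by (subst regr_unit) auto
    have "A *\<^sub>v regr m (k + 1) m = B *\<^sub>v regr m (k + 1) m"
    proof -
      have r: "k + 1 \<in> {1..m}" "m \<in> {1..m}" using k by auto
      have "regr m (\<sigma> (k + 1)) (\<sigma> m) = A *\<^sub>v regr m (k + 1) m"
        "regr m (\<sigma> (k + 1)) (\<sigma> m) = B *\<^sub>v regr m (k + 1) m"
        using A B r by blast+
      then show ?thesis by simp
    qed
    then show ?thesis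
      using mult_unit_vec_col[OF _ k, of A] mult_unit_vec_col[OF _ k, of B] A B unfolding e by simp
  qed
  then show "A = B" using A B by (intro mat_col_eqI) auto
qed

lemma Q_mat_inverse:
  assumes s: "\<sigma> permutes {1..m}"
  obtains B where "mat_inverse (Q_mat m \<sigma>) = Some B" "B \<in> carrier_mat (m - 1) (m - 1)"
    "Q_mat m \<sigma> * B = 1\<^sub>m (m - 1)" "B * Q_mat m \<sigma> = 1\<^sub>m (m - 1)"
proof -
  let ?n = "m - 1"
  let ?\<tau> = "inv_into UNIV \<sigma>"
  have t: "?\<tau> permutes {1..m}" using s by (rule permutes_inv)
  have Q: "Q_mat m \<rho> \<in> carrier_mat ?n ?n \<and>
     (\<forall>i\<in>{1..m}. \<forall>j\<in>{1..m}. regr m (\<rho> i) (\<rho> j) = Q_mat m \<rho> *\<^sub>v regr m i j)"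
    if "\<rho> permutes {1..m}" for \<rho>
    unfolding Q_mat_def by (rule theI'[OF Q_mat_unique[OF that]])
  note Qs = Q[OF s] and Qt = Q[OF t]
  have "Q_mat m ?\<tau> * Q_mat m \<sigma> = 1\<^sub>m ?n"
  proof (rule mat_col_eqI)
    fix k assume "k < dim_col (1\<^sub>m ?n :: real mat)"
    then have k: "k < ?n" by simp
    have e: "regr m (k + 1) m = unit_vec ?n k"
      using k by (subst regr_unit) auto
    have r: "k + 1 \<in> {1..m}" "m \<in> {1..m}" using k by auto
    then have r': "\<sigma> (k + 1) \<in> {1..m}" "\<sigma> m \<in> {1..m}"
      using permutes_in_image[OF s] by auto
    have "col (Q_mat m ?\<tau> * Q_mat m \<sigma>) k = (Q_mat m ?\<tau> * Q_mat m \<sigma>) *\<^sub>v unit_vec ?n k"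
      using Qs Qt k by (subst mult_unit_vec_col) auto
    also have "\<dots> = Q_mat m ?\<tau> *\<^sub>v (Q_mat m \<sigma> *\<^sub>v regr m (k + 1) m)"
      using Qs Qt unfolding e by (subst assoc_mult_mat_vec) auto
    also have "\<dots> = regr m (?\<tau> (\<sigma> (k + 1))) (?\<tau> (\<sigma> m))"
    proof -
      have "regr m (\<sigma> (k + 1)) (\<sigma> m) = Q_mat m \<sigma> *\<^sub>v regr m (k + 1) m"
        using Qs r by blast
      moreover have "regr m (?\<tau> (\<sigma> (k + 1))) (?\<tau> (\<sigma> m))
          = Q_mat m ?\<tau> *\<^sub>v regr m (\<sigma> (k + 1)) (\<sigma> m)"
        using Qt r' by blast
      ultimately show ?thesis by simp
    qed
    also have "\<dots> = col (1\<^sub>m ?n) k"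
      using permutes_inverses(2)[OF s] e k by simp
    finally show "col (Q_mat m ?\<tau> * Q_mat m \<sigma>) k = col (1\<^sub>m ?n) k" .
  qed (use Qs Qt in auto)
  then have u: "Q_mat m \<sigma> \<in> Units (ring_mat TYPE(real) ?n ())"
    using Qs Qt mat_mult_left_right_inverse[of "Q_mat m ?\<tau>" ?n "Q_mat m \<sigma>"]
    unfolding Units_def ring_mat_def by auto
  then obtain B where "mat_inverse (Q_mat m \<sigma>) = Some B"
    using mat_inverse(1)[of "Q_mat m \<sigma>" ?n "()"] Qs by (cases "mat_inverse (Q_mat m \<sigma>)") auto
  with mat_inverse(2)[of "Q_mat m \<sigma>" ?n] Qs that show thesis by blast
qed

end

end

theory Submission
  imports Defs
begin

text \<open>
  The core is the equivalence theorem of D-optimality for a saturated design, whose \<open>m - 1\<close> support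
  points have regression vectors forming a basis \<open>F\<close> (a singular saturated design is never optimal).
  In the coordinates of this basis the information matrix of the design is diagonal. Write the
  regression vector of a pair \<open>p\<close> as
  \<open>\<Sum>k. c p k * v (e k)\<close>, with \<open>e k\<close> the support points and \<open>v\<close> their regression vectors. Then the design
  is optimal if and only if its weights are equal and
  \<open>lam p * (\<Sum>k. (c p k)\<^sup>2 / lam (e k)) \<le> 1\<close> for every pair \<open>p\<close> (\<open>optimal_iff\<close>). Necessity comes from moving
  a little mass to \<open>p\<close>, a perturbation of rank one (\<open>det_diagonal_plus_rank_one\<close>). Sufficiency comes from
  Hadamard's inequality (\<open>Hadamard_gram\<close>) and \<open>y \<le> exp (y - 1)\<close>.

  For the edges of a path the coordinates of the pair of its \<open>i\<close>-th and \<open>j\<close>-th vertex are \<open>\<plusminus>1\<close> on the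
  edges between them and 0 elsewhere, by telescoping, and the criterion becomes the stated description
  of the region (\<open>path_design_optimal_iff\<close>). As \<open>1 / \<lambda>\<^sub>i\<^sub>j = 2 + 2 cosh (\<beta>\<^sub>i - \<beta>\<^sub>j)\<close> grows exponentially, the
  inequalities hold for parameters that are equally and widely spaced along the path
  (\<open>path_design_optimal_somewhere\<close>).

  Conversely (\<open>saturated_optimal_imp_path\<close>), the support of an optimal saturated design is a connected
  graph, its regression vectors being a basis. Two neighbours of a vertex must have
  parameters on opposite sides of the parameter of that vertex, since otherwise their own
  comparison would be informative enough to violate the criterion; hence all degrees are at most 2.
  A connected graph with this property has a Hamiltonian path (\<open>Hamiltonian_path_if_degree_le_2\<close>), and
  \<open>m - 1\<close> edges leave no room for others.

  Finally, \<open>Q\<^sub>\<sigma>\<^sup>-\<^sup>T\<close> transports the intensities of the pairs \<open>(i, j)\<close> to those of \<open>(\<sigma> i, \<sigma> j)\<close>, and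
  with them the inequalities that describe the regions (\<open>region_orbit\<close>).
\<close>

section \<open>Determinants of Gram matrices\<close>

text \<open>The sum of the matrices \<open>a p v\<^sub>p v\<^sub>p\<^sup>T\<close>. Information matrices have this form, and keep it under a change of
basis and under elimination of coordinates.\<close>

definition gram :: "nat \<Rightarrow> 'p set \<Rightarrow> ('p \<Rightarrow> real) \<Rightarrow> ('p \<Rightarrow> nat \<Rightarrow> real) \<Rightarrow> real mat" where
  "gram n P a v = mat n n (\<lambda>(r, s). \<Sum>p\<in>P. a p * v p r * v p s)"

lemma gram_carrier [simp]: "gram n P a v \<in> carrier_mat n n"
  by (simp add: gram_def)

lemma gram_cong:
  assumes "\<And>p. p \<in> P \<Longrightarrow> a p = b p"
  shows "gram n P a v = gram n P b v"
  using assms by (auto simp: gram_def intro!: eq_matI sum.cong)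

text \<open>Subtracting multiples of the first column from the others clears the rest of the first row; the
lower right block that remains is the Schur complement. This is the induction step for both
of the following determinant computations.\<close>

lemma det_Schur_complement:
  fixes N :: "nat \<Rightarrow> nat \<Rightarrow> real"
  assumes a: "N 0 0 \<noteq> 0"
  shows "det (mat (Suc n) (Suc n) (\<lambda>(r, s). N r s))
    = N 0 0 * det (mat n n (\<lambda>(r, s). N (Suc r) (Suc s) - N (Suc r) 0 * N 0 (Suc s) / N 0 0))"
proof -
  define A where "A = mat (Suc n) (Suc n) (\<lambda>(r, s). N r s)"
  define U where "U = mat (Suc n) (Suc n)
    (\<lambda>(r, s). (if r = s then 1 else 0) + (if r = 0 \<and> s \<noteq> 0 then - N 0 s / N 0 0 else 0))"
  define B where "B = A * U"
  have A: "A \<in> carrier_mat (Suc n) (Suc n)" and U: "U \<in> carrier_mat (Suc n) (Suc n)"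
    and B: "B \<in> carrier_mat (Suc n) (Suc n)" by (auto simp: A_def U_def B_def)
  have entry: "B $$ (r, s) = N r s - (if s = 0 then 0 else N r 0 * N 0 s / N 0 0)"
    if "r < Suc n" "s < Suc n" for r s
  proof -
    have "B $$ (r, s) = (\<Sum>k<Suc n. N r k * ((if k = s then 1 else 0)
        + (if k = 0 \<and> s \<noteq> 0 then - N 0 s / N 0 0 else 0)))"
      using that by (simp add: B_def A_def U_def scalar_prod_def lessThan_atLeast0)
    also have "\<dots> = (\<Sum>k<Suc n. if k = s then N r k else 0)
        + (\<Sum>k<Suc n. if k = 0 then (if s \<noteq> 0 then - N r 0 * N 0 s / N 0 0 else 0) else 0)"
      unfolding sum.distrib[symmetric] by (intro sum.cong) auto
    also have "\<dots> = N r s - (if s = 0 then 0 else N r 0 * N 0 s / N 0 0)"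
      using that by (simp del: sum.lessThan_Suc)
    finally show ?thesis .
  qed
  have "det U = prod_list (diag_mat U)"
    by (rule det_upper_triangular[OF _ U]) (auto simp: U_def upper_triangular_def)
  also have "diag_mat U = replicate (Suc n) 1"
    by (rule nth_equalityI) (auto simp: diag_mat_def U_def simp del: upt_Suc replicate_Suc)
  finally have "det A = det B"
    using det_mult[OF A U] by (simp add: B_def prod_list_replicate)
  also have "det B = (\<Sum>j<Suc n. B $$ (0, j) * cofactor B 0 j)"
    using laplace_expansion_row[OF B, of 0] by simp
  also have "\<dots> = (\<Sum>j<Suc n. if j = 0 then N 0 0 * cofactor B 0 0 else 0)"
    using a by (intro sum.cong) (auto simp: entry)
  also have "\<dots> = N 0 0 * det (mat_delete B 0 0)"
    by (simp add: cofactor_def del: sum.lessThan_Suc)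
  also have "mat_delete B 0 0
    = mat n n (\<lambda>(r, s). N (Suc r) (Suc s) - N (Suc r) 0 * N 0 (Suc s) / N 0 0)"
    using B by (intro eq_matI) (auto simp: mat_delete_def entry)
  finally show ?thesis by (simp add: A_def)
qed

lemma det_zero_first_row:
  assumes A: "(A :: real mat) \<in> carrier_mat (Suc n) (Suc n)"
    and z: "\<And>s. s < Suc n \<Longrightarrow> A $$ (0, s) = 0"
  shows "det A = 0"
  using laplace_expansion_row[OF A, of 0] z by simp

text \<open>Hadamard's inequality for positive semidefinite matrices. Writing the matrix as a Gram matrix makes
semidefiniteness evident and stable under the induction: eliminating the first coordinate by a
Gram--Schmidt step yields a Gram matrix with diagonal no larger than before. If the first diagonal entry is 0, so
is the whole first row.\<close>

lemma Hadamard_gram: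
  assumes "finite P" "\<And>p. p \<in> P \<Longrightarrow> 0 \<le> a p"
  shows "det (gram n P a v) \<le> (\<Prod>k<n. \<Sum>p\<in>P. a p * (v p k)\<^sup>2)"
proof (induction n arbitrary: v)
  case 0
  show ?case by (simp add: gram_def)
next
  case (Suc n)
  define N where "N r s = (\<Sum>p\<in>P. a p * v p r * v p s)" for r s
  have G: "gram (Suc n) P a v = mat (Suc n) (Suc n) (\<lambda>(r, s). N r s)"
    by (simp add: gram_def N_def)
  have diag: "(\<Sum>p\<in>P. a p * (v p k)\<^sup>2) = N k k" for k
    by (simp add: N_def power2_eq_square mult.assoc)
  have diag0: "0 \<le> N k k" for k
    unfolding diag[symmetric] using assms by (intro sum_nonneg) auto
  have sym: "N r s = N s r" for r s
    unfolding N_def by (intro sum.cong) auto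
  show ?case
  proof (cases "N 0 0 = 0")
    case True
    have "a p * (v p 0)\<^sup>2 = 0" if "p \<in> P" for p
      using True sum_nonneg_eq_0_iff[of P "\<lambda>p. a p * (v p 0)\<^sup>2"] assms that
      unfolding diag[symmetric] by auto
    then have "N 0 s = 0" for s
      unfolding N_def by (intro sum.neutral) auto
    then have "det (gram (Suc n) P a v) = 0"
      unfolding G by (intro det_zero_first_row) auto
    also have "0 \<le> (\<Prod>k<Suc n. N k k)"
      by (intro prod_nonneg) (auto simp: diag0)
    finally show ?thesis by (simp add: diag)
  next
    case False
    \<comment> \<open>projecting off the first coordinate in the \<open>a\<close>-weighted inner product on \<open>P\<close>\<close>
    define w where "w p r = v p (Suc r) - v p 0 * (N 0 (Suc r) / N 0 0)" for p r
    have w: "(\<Sum>p\<in>P. a p * w p r * w p s)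
        = N (Suc r) (Suc s) - N (Suc r) 0 * N 0 (Suc s) / N 0 0" for r s
    proof -
      have "(\<Sum>p\<in>P. a p * w p r * w p s) = (\<Sum>p\<in>P. a p * v p (Suc r) * v p (Suc s)
          - (N 0 (Suc s) / N 0 0) * (a p * v p (Suc r) * v p 0)
          - (N 0 (Suc r) / N 0 0) * (a p * v p 0 * v p (Suc s))
          + (N 0 (Suc r) / N 0 0) * (N 0 (Suc s) / N 0 0) * (a p * v p 0 * v p 0))"
        unfolding w_def by (intro sum.cong) (auto simp: algebra_simps)
      also have "\<dots> = N (Suc r) (Suc s) - (N 0 (Suc s) / N 0 0) * N (Suc r) 0
          - (N 0 (Suc r) / N 0 0) * N 0 (Suc s)
          + (N 0 (Suc r) / N 0 0) * (N 0 (Suc s) / N 0 0) * N 0 0"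
        by (simp only: sum.distrib sum_subtractf sum_distrib_left[symmetric] N_def[symmetric])
      also have "\<dots> = N (Suc r) (Suc s) - N (Suc r) 0 * N 0 (Suc s) / N 0 0"
        using False by (simp add: field_simps)
      finally show ?thesis .
    qed
    have "det (gram (Suc n) P a v) = N 0 0 * det (gram n P a w)"
      using det_Schur_complement[where N = N, OF False] by (simp only: G gram_def[of n] w)
    also have "\<dots> \<le> N 0 0 * (\<Prod>k<n. \<Sum>p\<in>P. a p * (w p k)\<^sup>2)"
      using Suc.IH diag0 by (intro mult_left_mono) auto
    also have "\<dots> \<le> N 0 0 * (\<Prod>k<n. N (Suc k) (Suc k))"
    proof (intro mult_left_mono prod_mono diag0 conjI)
      fix k
      show "0 \<le> (\<Sum>p\<in>P. a p * (w p k)\<^sup>2)" using assms by (intro sum_nonneg) auto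
      have "(\<Sum>p\<in>P. a p * (w p k)\<^sup>2) = N (Suc k) (Suc k) - N 0 (Suc k) * N 0 (Suc k) / N 0 0"
        using w[of k k] by (simp add: power2_eq_square mult.assoc sym[of "Suc k" 0])
      then show "(\<Sum>p\<in>P. a p * (w p k)\<^sup>2) \<le> N (Suc k) (Suc k)"
        using diag0[of 0] by simp
    qed
    also have "\<dots> = (\<Prod>k<Suc n. N k k)"
      by (simp add: prod.lessThan_Suc_shift del: prod.lessThan_Suc)
    finally show ?thesis by (simp only: diag)
  qed
qed

text \<open>Eliminating the first coordinate preserves the shape ``diagonal plus rank one'': only the factor
\<open>b\<close> changes, to \<open>b d\<^sub>0 / (d\<^sub>0 + b u\<^sub>0\<^sup>2)\<close>.\<close>

lemma det_diagonal_plus_rank_one: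
  fixes d u :: "nat \<Rightarrow> real"
  assumes "\<And>k. k < n \<Longrightarrow> 0 < d k" "0 \<le> b"
  shows "det (mat n n (\<lambda>(r, s). (if r = s then d r else 0) + b * u r * u s))
    = (\<Prod>k<n. d k) * (1 + b * (\<Sum>k<n. (u k)\<^sup>2 / d k))"
  using assms
proof (induction n arbitrary: d u b)
  case 0
  show ?case by simp
next
  case (Suc n)
  define N where "N r s = (if r = s then d r else 0) + b * u r * u s" for r s
  have d0: "0 < d 0" using Suc.prems by auto
  have pos: "0 < N 0 0"
    using d0 Suc.prems(2) by (simp add: N_def mult.assoc add_pos_nonneg)
  have "N (Suc r) (Suc s) - N (Suc r) 0 * N 0 (Suc s) / N 0 0
      = (if r = s then d (Suc r) else 0) + (b * d 0 / N 0 0) * u (Suc r) * u (Suc s)" for r s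
  proof -
    have "b * u (Suc r) * u (Suc s) * N 0 0 - b * u (Suc r) * u 0 * (b * u 0 * u (Suc s))
       = b * d 0 * u (Suc r) * u (Suc s)"
      by (simp add: N_def algebra_simps)
    then have "b * u (Suc r) * u (Suc s) - b * u (Suc r) * u 0 * (b * u 0 * u (Suc s)) / N 0 0
       = (b * d 0 / N 0 0) * u (Suc r) * u (Suc s)"
      using pos by (simp add: field_simps)
    then show ?thesis by (simp add: N_def)
  qed
  then have "det (mat (Suc n) (Suc n) (\<lambda>(r, s). N r s))
      = N 0 0 * det (mat n n (\<lambda>(r, s). (if r = s then d (Suc r) else 0)
          + (b * d 0 / N 0 0) * u (Suc r) * u (Suc s)))"
    using pos by (subst det_Schur_complement) auto
  also have "\<dots> = N 0 0 * ((\<Prod>k<n. d (Suc k))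
      * (1 + (b * d 0 / N 0 0) * (\<Sum>k<n. (u (Suc k))\<^sup>2 / d (Suc k))))"
    using Suc.prems d0 pos by (subst Suc.IH) (auto intro!: divide_nonneg_pos mult_nonneg_nonneg simp: less_imp_le)
  also have "\<dots> = (\<Prod>k<n. d (Suc k)) * (N 0 0 + b * d 0 * (\<Sum>k<n. (u (Suc k))\<^sup>2 / d (Suc k)))"
    using pos by (simp add: field_simps)
  also have "\<dots> = (\<Prod>k<n. d (Suc k)) * (d 0 * (1 + b * ((u 0)\<^sup>2 / d 0 + (\<Sum>k<n. (u (Suc k))\<^sup>2 / d (Suc k)))))"
    using d0 by (simp add: N_def field_simps power2_eq_square)
  also have "\<dots> = (\<Prod>k<Suc n. d k) * (1 + b * (\<Sum>k<Suc n. (u k)\<^sup>2 / d k))"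
    by (simp add: prod.lessThan_Suc_shift sum.lessThan_Suc_shift mult_ac
        del: prod.lessThan_Suc sum.lessThan_Suc)
  finally show ?case by (simp add: N_def)
qed

text \<open>\<open>v p = F *\<^sub>v c p\<close> turns the Gram matrix of \<open>v\<close> into \<open>F N F\<^sup>T\<close> with \<open>N\<close> the Gram matrix of \<open>c\<close>.\<close>

lemma det_gram_change_basis:
  assumes F: "F \<in> carrier_mat n n"
    and v: "\<And>p r. p \<in> P \<Longrightarrow> r < n \<Longrightarrow> v p r = (\<Sum>k<n. F $$ (r, k) * c p k)"
  shows "det (gram n P a v) = (det F)\<^sup>2 * det (gram n P a c)"
proof -
  have "gram n P a v = F * (gram n P a c * transpose_mat F)"
  proof (rule eq_matI)
    fix r s assume rs: "r < dim_row (F * (gram n P a c * transpose_mat F))"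
      "s < dim_col (F * (gram n P a c * transpose_mat F))"
    then have r: "r < n" and s: "s < n" using F by auto
    have "(F * (gram n P a c * transpose_mat F)) $$ (r, s)
        = (\<Sum>k<n. F $$ (r, k) * (\<Sum>l<n. (\<Sum>p\<in>P. a p * c p k * c p l) * F $$ (s, l)))"
      using F r s by (simp add: scalar_prod_def lessThan_atLeast0 gram_def)
    also have "\<dots> = (\<Sum>k<n. \<Sum>l<n. \<Sum>p\<in>P. F $$ (r, k) * (a p * c p k * c p l) * F $$ (s, l))"
      by (simp add: sum_distrib_left sum_distrib_right mult.assoc)
    also have "\<dots> = (\<Sum>k<n. \<Sum>p\<in>P. \<Sum>l<n. F $$ (r, k) * (a p * c p k * c p l) * F $$ (s, l))"
      by (intro sum.cong refl sum.swap)
    also have "\<dots> = (\<Sum>p\<in>P. \<Sum>k<n. \<Sum>l<n. F $$ (r, k) * (a p * c p k * c p l) * F $$ (s, l))"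
      by (rule sum.swap)
    also have "\<dots> = (\<Sum>p\<in>P. a p * v p r * v p s)"
    proof (intro sum.cong refl)
      fix p assume p: "p \<in> P"
      have "a p * v p r * v p s
          = a p * ((\<Sum>k<n. F $$ (r, k) * c p k) * (\<Sum>l<n. F $$ (s, l) * c p l))"
        by (simp add: v[OF p r] v[OF p s])
      also have "\<dots> = (\<Sum>k<n. \<Sum>l<n. F $$ (r, k) * (a p * c p k * c p l) * F $$ (s, l))"
        unfolding sum_product unfolding sum_distrib_left by (intro sum.cong refl) (simp add: mult_ac)
      finally show "(\<Sum>k<n. \<Sum>l<n. F $$ (r, k) * (a p * c p k * c p l) * F $$ (s, l))
          = a p * v p r * v p s" ..
    qed
    finally show "gram n P a v $$ (r, s) = (F * (gram n P a c * transpose_mat F)) $$ (r, s)"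
      using r s by (simp add: gram_def)
  qed (use F in \<open>auto simp: gram_def\<close>)
  moreover have "gram n P a c * transpose_mat F \<in> carrier_mat n n" "transpose_mat F \<in> carrier_mat n n"
    using F by (auto simp: gram_def)
  ultimately have "det (gram n P a v) = det F * (det (gram n P a c) * det (transpose_mat F))"
    using F by (simp add: det_mult[of _ n])
  then show ?thesis by (simp add: det_transpose[OF F] power2_eq_square)
qed

section \<open>Optimality of designs supported on a basis of regression vectors\<close>

definition weights :: "'p set \<Rightarrow> ('p \<Rightarrow> real) \<Rightarrow> bool" where
  "weights P w \<longleftrightarrow> (\<forall>p\<in>P. 0 \<le> w p) \<and> sum w P = 1"

text \<open>A design problem with regression vectors \<open>v p\<close> of length \<open>n\<close> and intensities \<open>lam p\<close>, together with a
design \<open>w\<close> whose support is enumerated by \<open>e\<close> and has as many points as there are parameters.\<close>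

locale saturated_support =
  fixes n :: nat and P :: "'p set" and v :: "'p \<Rightarrow> nat \<Rightarrow> real" and lam :: "'p \<Rightarrow> real"
    and e :: "nat \<Rightarrow> 'p" and w :: "'p \<Rightarrow> real"
  assumes n_pos: "0 < n" and finite_P: "finite P" and lam_pos: "\<And>p. p \<in> P \<Longrightarrow> 0 < lam p"
    and e_inj: "inj_on e {..<n}" and e_P: "\<And>k. k < n \<Longrightarrow> e k \<in> P"
    and w: "weights P w" and w_pos: "\<And>k. k < n \<Longrightarrow> 0 < w (e k)"
    and w_zero: "\<And>p. p \<in> P \<Longrightarrow> p \<notin> e ` {..<n} \<Longrightarrow> w p = 0"
begin

definition F :: "real mat" where
  "F = mat n n (\<lambda>(r, k). v (e k) r)"

definition M :: "('p \<Rightarrow> real) \<Rightarrow> real mat" where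
  "M w' = gram n P (\<lambda>p. w' p * lam p) v"

lemma F_carrier: "F \<in> carrier_mat n n"
  by (simp add: F_def)

lemma sum_support:
  "(\<Sum>p\<in>P. w p * g p) = (\<Sum>k<n. w (e k) * g (e k))"
proof -
  have "(\<Sum>p\<in>P. w p * g p) = (\<Sum>p\<in>e ` {..<n}. w p * g p)"
    using finite_P e_P w_zero by (intro sum.mono_neutral_right) auto
  also have "\<dots> = (\<Sum>k<n. w (e k) * g (e k))"
    by (simp add: sum.reindex[OF e_inj])
  finally show ?thesis .
qed

lemma sum_w: "(\<Sum>k<n. w (e k)) = 1"
  using sum_support[of "\<lambda>_. 1"] w by (simp add: weights_def)

text \<open>In the coordinates given by the columns of \<open>F\<close>, the support of \<open>w\<close> contributes a diagonal matrix and
the added point \<open>q\<close>, with coordinate vector \<open>c\<close>, a matrix of rank one. So the determinant along the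
segment from \<open>w\<close> to the one-point design in \<open>q\<close> is explicit.\<close>

lemma det_M_mix:
  assumes q: "q \<in> P" and c: "\<And>r. r < n \<Longrightarrow> v q r = (\<Sum>k<n. c k * v (e k) r)"
    and t: "0 \<le> t" "t < 1"
  shows "det (M (\<lambda>p. (1 - t) * w p + (if p = q then t else 0)))
    = (det F)\<^sup>2 * ((\<Prod>k<n. (1 - t) * w (e k) * lam (e k))
        * (1 + t * lam q * (\<Sum>k<n. (c k)\<^sup>2 / ((1 - t) * w (e k) * lam (e k)))))"
proof -
  define d where "d k = (1 - t) * w (e k) * lam (e k)" for k
  \<comment> \<open>index \<open>n\<close> stands for the added point, which may itself belong to the support\<close>
  define a where "a k = (if k < n then d k else t * lam q)" for k
  define u where "u k = (if k < n then v (e k) else v q)" for k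
  define C where "C k = (if k < n then (\<lambda>l. if l = k then 1 else 0) else c)" for k
  have "M (\<lambda>p. (1 - t) * w p + (if p = q then t else 0)) = gram n {..<Suc n} a u"
  proof -
    have "(\<Sum>p\<in>P. ((1 - t) * w p + (if p = q then t else 0)) * lam p * v p r * v p s)
        = (\<Sum>k<Suc n. a k * u k r * u k s)" for r s
    proof -
      have "(\<Sum>p\<in>P. ((1 - t) * w p + (if p = q then t else 0)) * lam p * v p r * v p s)
        = (\<Sum>p\<in>P. w p * ((1 - t) * lam p * v p r * v p s)
            + (if p = q then t * lam q * v q r * v q s else 0))"
        by (intro sum.cong) (auto simp: algebra_simps)
      also have "\<dots> = (\<Sum>k<n. w (e k) * ((1 - t) * lam (e k) * v (e k) r * v (e k) s))
            + t * lam q * v q r * v q s"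
        using q finite_P by (simp add: sum.distrib sum_support)
      also have "\<dots> = (\<Sum>k<Suc n. a k * u k r * u k s)"
        by (simp add: a_def u_def d_def mult_ac)
      finally show ?thesis .
    qed
    then show ?thesis by (simp add: M_def gram_def)
  qed
  also have "det (gram n {..<Suc n} a u) = (det F)\<^sup>2 * det (gram n {..<Suc n} a C)"
  proof (rule det_gram_change_basis[OF F_carrier])
    fix p r assume "p \<in> {..<Suc n}" and r: "r < n"
    show "u p r = (\<Sum>k<n. F $$ (r, k) * C p k)"
    proof (cases "p < n")
      case True
      have "(\<Sum>k<n. F $$ (r, k) * C p k) = (\<Sum>k<n. if k = p then v (e p) r else 0)"
        using r True by (intro sum.cong) (auto simp: F_def C_def)
      then show ?thesis using True by (simp add: u_def)
    next
      case False
      then show ?thesis using r c[OF r] by (simp add: u_def C_def F_def mult.commute)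
    qed
  qed
  also have "gram n {..<Suc n} a C
      = mat n n (\<lambda>(r, s). (if r = s then d r else 0) + t * lam q * c r * c s)"
  proof -
    have "(\<Sum>k<Suc n. a k * C k r * C k s) = (if r = s then d r else 0) + t * lam q * c r * c s"
      if "r < n" "s < n" for r s
    proof -
      have "(\<Sum>k<n. a k * C k r * C k s) = (\<Sum>k<n. if k = r then (if r = s then d r else 0) else 0)"
        by (intro sum.cong) (auto simp: a_def C_def)
      then show ?thesis using that by (simp add: a_def C_def)
    qed
    then show ?thesis by (auto simp: gram_def simp del: sum.lessThan_Suc intro!: eq_matI)
  qed
  also have "det \<dots> = (\<Prod>k<n. d k) * (1 + t * lam q * (\<Sum>k<n. (c k)\<^sup>2 / d k))"
    using t w_pos lam_pos e_P q
    by (intro det_diagonal_plus_rank_one) (auto simp: d_def less_imp_le)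
  finally show ?thesis by (simp only: d_def)
qed

lemma det_M_support: "det (M w) = (det F)\<^sup>2 * (\<Prod>k<n. w (e k) * lam (e k))"
proof -
  have "v (e 0) r = (\<Sum>k<n. (if k = 0 then 1 else 0) * v (e k) r)" if "r < n" for r
  proof -
    have "(\<Sum>k<n. (if k = 0 then 1 else 0) * v (e k) r) = (\<Sum>k<n. if k = 0 then v (e k) r else 0)"
      by (intro sum.cong) auto
    then show ?thesis using n_pos by simp
  qed
  from det_M_mix[OF e_P[OF n_pos] this, of 0] show ?thesis by simp
qed

text \<open>The necessary half of the equivalence theorem. With \<open>s\<close> the left-hand side, moving mass \<open>t\<close> to \<open>q\<close>
multiplies the determinant by \<open>(1 - t)\<^bsup>n - 1\<^esup> (1 + t (s - 1))\<close>, which has derivative \<open>s - n\<close> at \<open>t = 0\<close>.\<close>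

lemma optimal_weighted_sum_le:
  assumes opt: "\<And>w'. weights P w' \<Longrightarrow> det (M w') \<le> det (M w)" and F: "det F \<noteq> 0"
    and q: "q \<in> P" and c: "\<And>r. r < n \<Longrightarrow> v q r = (\<Sum>k<n. c k * v (e k) r)"
  shows "lam q * (\<Sum>k<n. (c k)\<^sup>2 / (w (e k) * lam (e k))) \<le> real n"
proof (rule ccontr)
  define s where "s = lam q * (\<Sum>k<n. (c k)\<^sup>2 / (w (e k) * lam (e k)))"
  assume "\<not> ?thesis"
  then have sn: "real n < s" by (simp add: s_def)
  have n1: "1 \<le> real n" using n_pos by simp
  \<comment> \<open>small enough that the quadratic error \<open>t\<^sup>2 (n - 1) (s - 1)\<close> in Bernoulli's bound uses up at most
    half of the first-order gain \<open>t (s - n)\<close>\<close>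
  define t where "t = (s - real n) / (2 * real n * (s - 1))"
  have s1: "0 < s - 1" using sn n1 by linarith
  have t0: "0 < t" unfolding t_def using sn s1 n1 by (intro divide_pos_pos mult_pos_pos) auto
  have "(s - real n) * 1 < (2 * real n) * (s - 1)"
  proof -
    have "2 * (s - 1) \<le> (2 * real n) * (s - 1)"
      using s1 n1 by (intro mult_right_mono) auto
    moreover have "(s - real n) * 1 < 2 * (s - 1)"
      using s1 n1 by simp
    ultimately show ?thesis by (rule less_le_trans[rotated])
  qed
  then have t1: "t < 1" using s1 n1 by (simp add: t_def)
  have D: "0 < (det F)\<^sup>2 * (\<Prod>k<n. w (e k) * lam (e k))"
    using F w_pos lam_pos e_P by (intro mult_pos_pos prod_pos) auto
  have "weights P (\<lambda>p. (1 - t) * w p + (if p = q then t else 0))"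
    using w t0 t1 q finite_P
    by (auto simp: weights_def sum.distrib sum_distrib_left[symmetric])
  from opt[OF this]
  have "(det F)\<^sup>2 * ((\<Prod>k<n. (1 - t) * w (e k) * lam (e k))
        * (1 + t * lam q * (\<Sum>k<n. (c k)\<^sup>2 / ((1 - t) * w (e k) * lam (e k)))))
      \<le> (det F)\<^sup>2 * (\<Prod>k<n. w (e k) * lam (e k))"
    using det_M_mix[OF q c, of t] t0 t1 by (simp add: det_M_support)
  also have "(\<Prod>k<n. (1 - t) * w (e k) * lam (e k)) = (1 - t) ^ n * (\<Prod>k<n. w (e k) * lam (e k))"
    by (simp add: prod.distrib mult.assoc)
  also have "(\<Sum>k<n. (c k)\<^sup>2 / ((1 - t) * w (e k) * lam (e k)))
      = (\<Sum>k<n. (c k)\<^sup>2 / (w (e k) * lam (e k))) / (1 - t)"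
    by (simp add: sum_divide_distrib mult_ac)
  also have "(det F)\<^sup>2 * ((1 - t) ^ n * (\<Prod>k<n. w (e k) * lam (e k))
        * (1 + t * lam q * ((\<Sum>k<n. (c k)\<^sup>2 / (w (e k) * lam (e k))) / (1 - t))))
      = ((det F)\<^sup>2 * (\<Prod>k<n. w (e k) * lam (e k))) * ((1 - t) ^ n * (1 + t * s / (1 - t)))"
    by (simp add: s_def mult_ac)
  finally have "(1 - t) ^ n * (1 + t * s / (1 - t)) \<le> 1"
    using mult_le_cancel_left_pos[OF D, of "(1 - t) ^ n * (1 + t * s / (1 - t))" 1]
    by (simp only: mult_1_right)
  also have "(1 - t) ^ n * (1 + t * s / (1 - t)) = (1 - t) ^ (n - 1) * (1 + t * (s - 1))"
  proof -
    have "(1 - t) ^ n = (1 - t) ^ (n - 1) * (1 - t)"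
      using n_pos by (metis power_minus_mult)
    moreover have "(1 - t) * (1 + t * s / (1 - t)) = 1 + t * (s - 1)"
      using t1 by (simp add: field_simps)
    ultimately show ?thesis by (simp only: mult.assoc)
  qed
  finally have "(1 - t) ^ (n - 1) * (1 + t * (s - 1)) \<le> 1" .
  moreover have "1 - real (n - 1) * t \<le> (1 - t) ^ (n - 1)"
    using Bernoulli_inequality[of "- t" "n - 1"] t1 by simp
  then have "(1 - real (n - 1) * t) * (1 + t * (s - 1)) \<le> (1 - t) ^ (n - 1) * (1 + t * (s - 1))"
    using t0 s1 by (intro mult_right_mono) auto
  ultimately have "(1 - real (n - 1) * t) * (1 + t * (s - 1)) \<le> 1" by linarith
  then have "t * (s - real n) \<le> t * (t * ((real n - 1) * (s - 1)))"
    using n_pos by (simp add: algebra_simps of_nat_diff)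
  then have "s - real n \<le> t * ((real n - 1) * (s - 1))"
    using t0 by simp
  also have "\<dots> \<le> t * (real n * (s - 1))"
    using t0 s1 by (intro mult_left_mono mult_right_mono) auto
  also have "\<dots> = (s - real n) / 2"
    using s1 n1 by (simp add: t_def field_simps)
  finally show False using sn by simp
qed

text \<open>For a support point \<open>q = e k\<close> the bound of \<open>optimal_weighted_sum_le\<close> reads \<open>1 / w (e k) \<le> n\<close>. So every
weight is at least \<open>1 / n\<close>, and the weights sum to 1.\<close>

lemma optimal_imp_uniform:
  assumes opt: "\<And>w'. weights P w' \<Longrightarrow> det (M w') \<le> det (M w)" and F: "det F \<noteq> 0"
    and k: "k < n"
  shows "w (e k) = 1 / real n"
proof -
  have ge: "1 / real n \<le> w (e k)" if k: "k < n" for k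
  proof -
    have "v (e k) r = (\<Sum>l<n. (if l = k then 1 else 0) * v (e l) r)" if "r < n" for r
    proof -
      have "(\<Sum>l<n. (if l = k then 1 else 0) * v (e l) r) = (\<Sum>l<n. if l = k then v (e l) r else 0)"
        by (intro sum.cong) auto
      then show ?thesis using k by simp
    qed
    from optimal_weighted_sum_le[OF opt F e_P[OF k] this]
    have "lam (e k) * (\<Sum>l<n. (if l = k then 1 else 0)\<^sup>2 / (w (e l) * lam (e l))) \<le> real n" .
    also have "(\<Sum>l<n. (if l = k then 1 else 0)\<^sup>2 / (w (e l) * lam (e l)))
        = (\<Sum>l<n. if l = k then 1 / (w (e k) * lam (e k)) else 0)"
      by (intro sum.cong) auto
    finally have "1 / w (e k) \<le> real n"
      using k lam_pos[OF e_P[OF k]] by (simp add: field_simps)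
    then show ?thesis
      using w_pos[OF k] n_pos by (simp add: field_simps)
  qed
  have "(\<Sum>l<n. w (e l) - 1 / real n) = 0"
    using sum_w n_pos by (simp add: sum_subtractf)
  then have "w (e k) - 1 / real n = 0"
    using ge k by (subst (asm) sum_nonneg_eq_0_iff) auto
  then show ?thesis by simp
qed

lemma optimal_sum_le:
  assumes opt: "\<And>w'. weights P w' \<Longrightarrow> det (M w') \<le> det (M w)" and F: "det F \<noteq> 0"
    and q: "q \<in> P" and c: "\<And>r. r < n \<Longrightarrow> v q r = (\<Sum>k<n. c k * v (e k) r)"
  shows "lam q * (\<Sum>k<n. (c k)\<^sup>2 / lam (e k)) \<le> 1"
proof -
  have "lam q * (\<Sum>k<n. (c k)\<^sup>2 / (w (e k) * lam (e k))) \<le> real n"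
    by (rule optimal_weighted_sum_le[OF opt F q c])
  also have "(\<Sum>k<n. (c k)\<^sup>2 / (w (e k) * lam (e k))) = real n * (\<Sum>k<n. (c k)\<^sup>2 / lam (e k))"
    unfolding sum_distrib_left using optimal_imp_uniform[OF opt F] by (intro sum.cong) auto
  finally show ?thesis
    using n_pos by (simp add: mult.left_commute)
qed

text \<open>The equivalence theorem for saturated designs. For sufficiency, let \<open>d k\<close> be the diagonal entries of
the information matrix of a competitor \<open>w'\<close> in the coordinates \<open>F\<close>. Hadamard's inequality bounds its
determinant by their product, and \<open>y \<le> exp (y - 1)\<close> for the normalised entries \<open>y k = n d k / lam (e k)\<close>
bounds the product of the latter by \<open>exp (\<Sum>k. y k - 1)\<close>, whose exponent is at most 0 by the inequalities.\<close>

lemma optimal_iff: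
  assumes F: "det F \<noteq> 0"
    and c: "\<And>p r. p \<in> P \<Longrightarrow> r < n \<Longrightarrow> v p r = (\<Sum>k<n. c p k * v (e k) r)"
  shows "(\<forall>w'. weights P w' \<longrightarrow> det (M w') \<le> det (M w)) \<longleftrightarrow>
    (\<forall>k<n. w (e k) = 1 / real n) \<and> (\<forall>p\<in>P. lam p * (\<Sum>k<n. (c p k)\<^sup>2 / lam (e k)) \<le> 1)"
    (is "?opt \<longleftrightarrow> ?unif \<and> ?ineq")
proof (intro iffI conjI)
  assume opt: ?opt
  then show ?unif
    using optimal_imp_uniform[OF _ F] by blast
  show ?ineq
    using opt optimal_sum_le[OF _ F _ c] by blast
next
  assume A: "?unif \<and> ?ineq"
  show ?opt
  proof (intro allI impI)
    fix w' assume w': "weights P w'"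
    define d where "d k = (\<Sum>p\<in>P. w' p * lam p * (c p k)\<^sup>2)" for k
    define y where "y k = real n * d k / lam (e k)" for k
    have d0: "0 \<le> d k" for k
      unfolding d_def using w' lam_pos by (intro sum_nonneg) (auto simp: weights_def less_imp_le)
    have le: "0 < lam (e k)" if "k < n" for k using lam_pos e_P that by blast
    have y0: "0 \<le> y k" if "k < n" for k
      unfolding y_def using d0[of k] le[OF that] by auto
    have "(\<Sum>k<n. y k) = real n * (\<Sum>p\<in>P. w' p * (lam p * (\<Sum>k<n. (c p k)\<^sup>2 / lam (e k))))"
    proof -
      have "(\<Sum>k<n. y k) = (\<Sum>k<n. \<Sum>p\<in>P. real n * w' p * lam p * (c p k)\<^sup>2 / lam (e k))"
        by (simp add: y_def d_def sum_distrib_left sum_divide_distrib mult_ac)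
      also have "\<dots> = (\<Sum>p\<in>P. \<Sum>k<n. real n * w' p * lam p * (c p k)\<^sup>2 / lam (e k))"
        by (rule sum.swap)
      finally show ?thesis by (simp add: sum_distrib_left mult_ac)
    qed
    also have "\<dots> \<le> real n * (\<Sum>p\<in>P. w' p * 1)"
      using A w' by (intro mult_left_mono sum_mono) (auto simp: weights_def)
    also have "\<dots> = real n" using w' by (simp add: weights_def)
    finally have sum_y: "(\<Sum>k<n. y k - 1) \<le> 0" by (simp add: sum_subtractf)
    have "(\<Prod>k<n. y k) \<le> (\<Prod>k<n. exp (y k - 1))"
    proof (intro prod_mono conjI)
      fix k assume "k \<in> {..<n}"
      then show "0 \<le> y k" using y0 by simp
      show "y k \<le> exp (y k - 1)" using exp_ge_add_one_self[of "y k - 1"] by simp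
    qed
    also have "\<dots> = exp (\<Sum>k<n. y k - 1)" by (simp add: exp_sum)
    also have "\<dots> \<le> 1" using sum_y by simp
    finally have prod_y: "(\<Prod>k<n. y k) \<le> 1" .
    have "det (M w') = (det F)\<^sup>2 * det (gram n P (\<lambda>p. w' p * lam p) c)"
      unfolding M_def
    proof (rule det_gram_change_basis[OF F_carrier])
      fix p r assume "p \<in> P" "r < n"
      then show "v p r = (\<Sum>k<n. F $$ (r, k) * c p k)"
        using c by (simp add: F_def mult.commute)
    qed
    also have "\<dots> \<le> (det F)\<^sup>2 * (\<Prod>k<n. d k)"
      unfolding d_def using w' lam_pos finite_P
      by (intro mult_left_mono Hadamard_gram) (auto simp: weights_def less_imp_le)
    also have "(\<Prod>k<n. d k) = (\<Prod>k<n. w (e k) * lam (e k) * y k)"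
      using A n_pos less_imp_neq[OF le] by (intro prod.cong) (auto simp: y_def)
    also have "\<dots> = (\<Prod>k<n. w (e k) * lam (e k)) * (\<Prod>k<n. y k)"
      by (rule prod.distrib)
    also have "(det F)\<^sup>2 * ((\<Prod>k<n. w (e k) * lam (e k)) * (\<Prod>k<n. y k))
        \<le> (det F)\<^sup>2 * ((\<Prod>k<n. w (e k) * lam (e k)) * 1)"
      using prod_y le w_pos by (intro mult_left_mono prod_nonneg) (auto simp: less_imp_le)
    finally show "det (M w') \<le> det (M w)" by (simp add: det_M_support)
  qed
qed

end

section \<open>Paths in graphs on the alternatives\<close>

definition path_edges :: "nat \<Rightarrow> (nat \<Rightarrow> nat) \<Rightarrow> (nat \<times> nat) set" where
  "path_edges m \<sigma> = {act_pair \<sigma> (k, k + 1) | k. 1 \<le> k \<and> k < m}"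

lemma finite_pairs [simp]: "finite (pairs m)"
  by (rule finite_subset[of _ "{1..m} \<times> {1..m}"]) (auto simp: pairs_def)

lemma adj_sym: "adj E u v \<Longrightarrow> adj E v u"
  by (auto simp: adj_def)

lemma adj_range: "E \<subseteq> pairs m \<Longrightarrow> adj E u v \<Longrightarrow> u \<in> {1..m} \<and> v \<in> {1..m} \<and> u \<noteq> v"
  by (auto simp: adj_def pairs_def)

lemma finite_neighbours: "E \<subseteq> pairs m \<Longrightarrow> finite {v. adj E u v}"
  by (rule finite_subset[of _ "{1..m}"]) (use adj_range in blast)+

lemma adj_iff_act_pair:
  assumes "E \<subseteq> pairs m" "\<sigma> i \<noteq> \<sigma> j"
  shows "adj E (\<sigma> i) (\<sigma> j) \<longleftrightarrow> act_pair \<sigma> (i, j) \<in> E"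
proof (cases "\<sigma> i < \<sigma> j")
  case True
  then have "(\<sigma> j, \<sigma> i) \<notin> E" using assms(1) by (auto simp: pairs_def)
  then show ?thesis using True by (auto simp: adj_def act_pair_def min_def max_def)
next
  case False
  then have "(\<sigma> i, \<sigma> j) \<notin> E" using assms(1) by (auto simp: pairs_def)
  then show ?thesis using False assms(2) by (auto simp: adj_def act_pair_def min_def max_def)
qed

lemma act_pair_inverse:
  assumes "\<sigma> permutes {1..m}" "i < j"
  shows "act_pair (inv_into UNIV \<sigma>) (act_pair \<sigma> (i, j)) = (i, j)"
    "act_pair \<sigma> (act_pair (inv_into UNIV \<sigma>) (i, j)) = (i, j)"
  using assms by (auto simp: act_pair_def min_def max_def permutes_inverses)

lemma act_pair_in_pairs:
  assumes s: "\<sigma> permutes {1..m}" and "p \<in> pairs m"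
  shows "act_pair \<sigma> p \<in> pairs m"
proof -
  obtain i j where p: "p = (i, j)" "1 \<le> i" "i < j" "j \<le> m"
    using assms(2) by (auto simp: pairs_def)
  then have "\<sigma> i \<in> {1..m}" "\<sigma> j \<in> {1..m}"
    using permutes_in_image[OF s] by auto
  moreover have "\<sigma> i \<noteq> \<sigma> j" using inj_eq[OF permutes_inj[OF s]] p by simp
  ultimately show ?thesis by (auto simp: p(1) act_pair_def pairs_def min_def max_def)
qed

lemma path_edges_subset:
  assumes "\<sigma> permutes {1..m}"
  shows "path_edges m \<sigma> \<subseteq> pairs m"
proof
  fix p assume "p \<in> path_edges m \<sigma>"
  then obtain k where k: "p = act_pair \<sigma> (k, k + 1)" "1 \<le> k" "k < m"
    by (auto simp: path_edges_def)
  then have "(k, k + 1) \<in> pairs m" by (auto simp: pairs_def)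
  then show "p \<in> pairs m" using act_pair_in_pairs[OF assms] k by simp
qed

lemma path_edges_enum:
  assumes s: "\<sigma> permutes {1..m}"
  shows "bij_betw (\<lambda>k. act_pair \<sigma> (k + 1, k + 2)) {..<m - 1} (path_edges m \<sigma>)"
proof (intro bij_betw_imageI)
  show "inj_on (\<lambda>k. act_pair \<sigma> (k + 1, k + 2)) {..<m - 1}"
  proof (rule inj_onI)
    fix k l assume "act_pair \<sigma> (k + 1, k + 2) = act_pair \<sigma> (l + 1, l + 2)"
    then have "act_pair (inv_into UNIV \<sigma>) (act_pair \<sigma> (k + 1, k + 2))
      = act_pair (inv_into UNIV \<sigma>) (act_pair \<sigma> (l + 1, l + 2))" by simp
    then have "(k + 1, k + 2) = (l + 1, l + 2)"
      using act_pair_inverse(1)[OF s, of "k + 1" "k + 2"] act_pair_inverse(1)[OF s, of "l + 1" "l + 2"]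
      by simp
    then show "k = l" by simp
  qed
  show "(\<lambda>k. act_pair \<sigma> (k + 1, k + 2)) ` {..<m - 1} = path_edges m \<sigma>"
  proof (intro equalityI subsetI)
    fix p assume "p \<in> path_edges m \<sigma>"
    then obtain k where k: "p = act_pair \<sigma> (k, k + 1)" "1 \<le> k" "k < m"
      by (auto simp: path_edges_def)
    then have "p = (\<lambda>k. act_pair \<sigma> (k + 1, k + 2)) (k - 1)" "k - 1 \<in> {..<m - 1}" by auto
    then show "p \<in> (\<lambda>k. act_pair \<sigma> (k + 1, k + 2)) ` {..<m - 1}" by blast
  next
    fix p assume "p \<in> (\<lambda>k. act_pair \<sigma> (k + 1, k + 2)) ` {..<m - 1}"
    then obtain k where "p = act_pair \<sigma> (k + 1, (k + 1) + 1)" "k < m - 1" by auto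
    then show "p \<in> path_edges m \<sigma>" unfolding path_edges_def by force
  qed
qed

lemma card_path_edges: "\<sigma> permutes {1..m} \<Longrightarrow> card (path_edges m \<sigma>) = m - 1"
  using bij_betw_same_card[OF path_edges_enum] by simp

text \<open>A longest simple path visits every vertex. Otherwise connectedness gives an edge leaving the path;
it cannot leave from an inner vertex, which has its two neighbours on the path, and leaving from an
end vertex it would extend the path.\<close>

lemma Hamiltonian_path_if_degree_le_2:
  assumes E: "E \<subseteq> pairs m" and m: "1 \<le> m"
    and conn: "\<And>u v. u \<in> {1..m} \<Longrightarrow> v \<in> {1..m} \<Longrightarrow> (adj E)\<^sup>*\<^sup>* u v"
    and deg: "\<And>u. u \<in> {1..m} \<Longrightarrow> card {v. adj E u v} \<le> 2"
  obtains \<sigma> where "\<sigma> permutes {1..m}" "path_edges m \<sigma> \<subseteq> E"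
proof -
  define simple where "simple vs \<longleftrightarrow> vs \<noteq> [] \<and> distinct vs \<and> set vs \<subseteq> {1..m} \<and>
    (\<forall>k. Suc k < length vs \<longrightarrow> adj E (vs ! k) (vs ! Suc k))" for vs
  have "simple [1]" using m by (simp add: simple_def)
  moreover have "length vs < Suc m" if "simple vs" for vs
    using that card_mono[of "{1..m}" "set vs"] by (auto simp: simple_def distinct_card)
  ultimately obtain vs where vs: "simple vs" and max: "\<And>ws. simple ws \<Longrightarrow> length ws \<le> length vs"
    using ex_has_greatest_nat_lemma[of simple "[1]" length "Suc m"]
    by (metis ex_has_greatest_nat less_imp_le_nat)
  have chain: "adj E (vs ! l) (vs ! Suc l)" if "Suc l < length vs" for l
    using vs that by (simp add: simple_def)
  have cover: "set vs = {1..m}"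
  proof (rule ccontr)
    assume "set vs \<noteq> {1..m}"
    then obtain z where z: "z \<in> {1..m}" "z \<notin> set vs" using vs unfolding simple_def by blast
    have "\<exists>x y. x \<in> set vs \<and> y \<notin> set vs \<and> adj E x y"
    proof (rule ccontr)
      assume none: "\<not> ?thesis"
      have "(adj E)\<^sup>*\<^sup>* (hd vs) y \<Longrightarrow> y \<in> set vs" for y
        by (induction rule: rtranclp_induct) (use none vs in \<open>auto simp: simple_def\<close>)
      moreover have "hd vs \<in> {1..m}" using vs hd_in_set[of vs] unfolding simple_def by blast
      ultimately show False using conn[OF _ z(1), of "hd vs"] z(2) by blast
    qed
    then obtain x y where x: "x \<in> set vs" and y: "y \<notin> set vs" and xy: "adj E x y" by blast
    have ym: "y \<in> {1..m}" using adj_range[OF E xy] by simp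
    obtain k where k: "k < length vs" "vs ! k = x" using x by (auto simp: in_set_conv_nth)
    consider "k = 0" | "Suc k = length vs" | "0 < k" "Suc k < length vs" using k by linarith
    then show False
    proof cases
      case 1
      have "simple (y # vs)"
        using vs y ym k 1 adj_sym[OF xy]
        by (auto simp: simple_def nth_Cons hd_conv_nth split: nat.splits)
      then show False using max by fastforce
    next
      case 2
      have "adj E ((vs @ [y]) ! l) ((vs @ [y]) ! Suc l)" if "Suc l < length (vs @ [y])" for l
      proof (cases "Suc l = length vs")
        case True
        then have "l = k" using 2 by simp
        then show ?thesis using True k xy by (simp add: nth_append)
      next
        case False
        then show ?thesis using that vs by (simp add: simple_def nth_append)
      qed
      then have "simple (vs @ [y])"
        using vs y ym by (auto simp: simple_def)
      then show False using max by fastforce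
    next
      case 3
      have "adj E (vs ! (k - 1)) (vs ! Suc (k - 1))"
        using 3 by (intro chain) simp
      then have a1: "adj E x (vs ! (k - 1))"
        using adj_sym 3 k(2) by simp
      have a2: "adj E x (vs ! Suc k)"
        using 3 vs k(2) by (auto simp: simple_def)
      have ne: "vs ! (k - 1) \<noteq> vs ! Suc k"
        using 3 vs by (subst nth_eq_iff_index_eq) (auto simp: simple_def)
      have "{vs ! (k - 1), vs ! Suc k, y} \<subseteq> {v. adj E x v}"
        using a1 a2 xy by auto
      moreover have "card {vs ! (k - 1), vs ! Suc k, y} = 3"
      proof -
        have "vs ! (k - 1) \<in> set vs" "vs ! Suc k \<in> set vs" using 3 by auto
        then have "y \<noteq> vs ! (k - 1)" "y \<noteq> vs ! Suc k" using y by blast+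
        then show ?thesis using ne by (simp add: card_insert_if)
      qed
      ultimately have "3 \<le> card {v. adj E x v}"
        using card_mono[OF finite_neighbours[OF E]] by metis
      then show False using deg[of x] adj_range[OF E xy] by simp
    qed
  qed
  have len: "length vs = m"
    using vs cover distinct_card[of vs] by (simp add: simple_def)
  define \<sigma> where "\<sigma> k = (if k \<in> {1..m} then vs ! (k - 1) else k)" for k
  have "bij_betw (\<lambda>k. vs ! (k - 1)) {1..m} {1..m}"
  proof (rule bij_betw_trans[of "\<lambda>k. k - 1" "{1..m}" "{..<m}" "(!) vs", unfolded comp_def])
    show "bij_betw (\<lambda>k. k - 1) {1..m} {..<m}"
      by (rule bij_betwI[of _ _ _ Suc]) auto
    show "bij_betw ((!) vs) {..<m} {1..m}"
      using vs cover len by (intro bij_betw_nth) (auto simp: simple_def)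
  qed
  then have "bij_betw \<sigma> {1..m} {1..m}"
    by (rule bij_betw_cong[THEN iffD1, rotated]) (simp add: \<sigma>_def)
  then have s: "\<sigma> permutes {1..m}"
    by (rule bij_imp_permutes) (auto simp: \<sigma>_def)
  have "act_pair \<sigma> (k, k + 1) \<in> E" if k: "1 \<le> k" "k < m" for k
  proof -
    have "adj E (vs ! (k - 1)) (vs ! Suc (k - 1))"
      using k len by (intro chain) simp
    then have a: "adj E (\<sigma> k) (\<sigma> (k + 1))" using k by (simp add: \<sigma>_def)
    then show ?thesis using adj_iff_act_pair[OF E] adj_range[OF E a] by blast
  qed
  then have "path_edges m \<sigma> \<subseteq> E" by (auto simp: path_edges_def)
  with s that show thesis by blast
qed

text \<open>The Hamiltonian path exhausts the edges, since an additional edge would be a chord and close a cycle.\<close>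

lemma path_on_imp_path_edges:
  assumes p: "path_on m E" and m: "1 \<le> m"
  obtains \<sigma> where "\<sigma> permutes {1..m}" "E = path_edges m \<sigma>"
proof -
  have E: "E \<subseteq> pairs m" and acyc: "\<nexists>vs. cycle_in E vs"
    using p by (auto simp: path_on_def tree_on_def)
  obtain \<sigma> where s: "\<sigma> permutes {1..m}" and sub: "path_edges m \<sigma> \<subseteq> E"
    using p by (auto intro: Hamiltonian_path_if_degree_le_2[OF E m] simp: path_on_def tree_on_def)
  have "E \<subseteq> path_edges m \<sigma>"
  proof
    fix q assume q: "q \<in> E"
    define a b where "a = fst (act_pair (inv_into UNIV \<sigma>) q)" and "b = snd (act_pair (inv_into UNIV \<sigma>) q)"
    have "act_pair (inv_into UNIV \<sigma>) q \<in> pairs m"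
      using q E act_pair_in_pairs[OF permutes_inv[OF s]] by blast
    then have ab: "1 \<le> a" "a < b" "b \<le> m" by (auto simp: a_def b_def pairs_def)
    have q': "q = act_pair \<sigma> (a, b)"
      using act_pair_inverse(2)[OF s, of "fst q" "snd q"] q E by (auto simp: a_def b_def pairs_def)
    show "q \<in> path_edges m \<sigma>"
    proof (cases "b = a + 1")
      case True
      then show ?thesis using q' ab by (auto simp: path_edges_def)
    next
      case False
      define vs where "vs = map \<sigma> [a..<b + 1]"
      have L: "length vs = b + 1 - a" by (simp add: vs_def del: upt_Suc)
      have nth: "vs ! k = \<sigma> (a + k)" if "k < length vs" for k
        using that by (simp add: vs_def del: upt_Suc)
      have inj: "\<sigma> i \<noteq> \<sigma> j" if "i \<noteq> j" for i j
        using inj_eq[OF permutes_inj[OF s]] that by simp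
      have "adj E (vs ! k) (vs ! ((k + 1) mod length vs))" if k: "k < length vs" for k
      proof (cases "k + 1 = length vs")
        case True
        then have "a + k = b" using L ab by linarith
        then have "vs ! k = \<sigma> b" using nth[OF k] by simp
        moreover have "vs ! ((k + 1) mod length vs) = \<sigma> a"
          unfolding True using nth[OF order.strict_trans1[OF le0 k]] by simp
        moreover have "adj E (\<sigma> a) (\<sigma> b)"
          using adj_iff_act_pair[OF E, of \<sigma> a b] inj[of a b] ab q q' by auto
        ultimately show ?thesis using adj_sym by simp
      next
        case False
        then have k1: "k + 1 < length vs" using k by simp
        have "act_pair \<sigma> (a + k, (a + k) + 1) \<in> path_edges m \<sigma>"
          unfolding path_edges_def using k1 L ab by force
        then have "adj E (\<sigma> (a + k)) (\<sigma> ((a + k) + 1))"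
          using adj_iff_act_pair[OF E, of \<sigma> "a + k" "(a + k) + 1"] inj[of "a + k" "(a + k) + 1"] sub
            by auto
        then show ?thesis using nth[OF k] nth[OF k1] k1 by simp
      qed
      moreover have "distinct vs"
        unfolding vs_def distinct_map using permutes_inj_on[OF s] by auto
      moreover have "3 \<le> length vs" using L ab False by simp
      ultimately have "cycle_in E vs" by (simp add: cycle_in_def)
      with acyc show ?thesis by blast
    qed
  qed
  with s sub that show thesis by blast
qed

lemma adj_path_edges:
  assumes s: "\<sigma> permutes {1..m}" and a: "adj (path_edges m \<sigma>) (\<sigma> i) (\<sigma> j)"
  shows "j = i + 1 \<or> i = j + 1"
proof -
  have eq: "\<sigma> x = \<sigma> y \<longleftrightarrow> x = y" for x y using inj_eq[OF permutes_inj[OF s]] by simp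
  from a obtain k where "(\<sigma> i, \<sigma> j) = act_pair \<sigma> (k, k + 1) \<or> (\<sigma> j, \<sigma> i) = act_pair \<sigma> (k, k + 1)"
    by (auto simp: adj_def path_edges_def)
  moreover have "act_pair \<sigma> (k, k + 1) \<in> {(\<sigma> k, \<sigma> (k + 1)), (\<sigma> (k + 1), \<sigma> k)}"
    by (auto simp: act_pair_def min_def max_def)
  ultimately have "\<sigma> i = \<sigma> k \<and> \<sigma> j = \<sigma> (k + 1) \<or> \<sigma> i = \<sigma> (k + 1) \<and> \<sigma> j = \<sigma> k" by auto
  then show ?thesis unfolding eq by auto
qed

lemma path_on_path_edges:
  assumes s: "\<sigma> permutes {1..m}"
  shows "path_on m (path_edges m \<sigma>)"
proof -
  let ?E = "path_edges m \<sigma>"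
  let ?\<tau> = "inv_into UNIV \<sigma>"
  have E: "?E \<subseteq> pairs m" by (rule path_edges_subset[OF s])
  have t: "\<sigma> (?\<tau> u) = u" for u using permutes_inverses(1)[OF s] .
  have edge: "adj ?E (\<sigma> k) (\<sigma> (Suc k))" if "1 \<le> k" "k < m" for k
  proof -
    have "act_pair \<sigma> (k, Suc k) \<in> ?E" using that by (auto simp: path_edges_def)
    moreover have "\<sigma> k \<noteq> \<sigma> (Suc k)" using inj_eq[OF permutes_inj[OF s]] by simp
    ultimately show ?thesis using adj_iff_act_pair[OF E] by blast
  qed
  have from1: "(adj ?E)\<^sup>*\<^sup>* (\<sigma> 1) (\<sigma> k)" if "1 \<le> k" "k \<le> m" for k
    using that(1,2)
  proof (induction k rule: dec_induct)
    case base
    show ?case by simp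
  next
    case (step k)
    then have "(adj ?E)\<^sup>*\<^sup>* (\<sigma> 1) (\<sigma> k)" by simp
    moreover have "adj ?E (\<sigma> k) (\<sigma> (Suc k))"
      using edge step by simp
    ultimately show ?case by (rule rtranclp.rtrancl_into_rtrancl)
  qed
  have from1': "(adj ?E)\<^sup>*\<^sup>* (\<sigma> 1) u" if "u \<in> {1..m}" for u
  proof -
    have "?\<tau> u \<in> {1..m}" using permutes_in_image[OF permutes_inv[OF s]] that by blast
    then show ?thesis using from1[of "?\<tau> u"] t by simp
  qed
  have "symp (adj ?E)" by (auto intro: sympI adj_sym)
  then have "symp (adj ?E)\<^sup>*\<^sup>*" by (rule symp_rtranclp)
  then have conn: "(adj ?E)\<^sup>*\<^sup>* u v" if "u \<in> {1..m}" "v \<in> {1..m}" for u v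
    using from1'[OF that(1)] from1'[OF that(2)] by (meson rtranclp_trans sympD)
  have acyc: "\<not> cycle_in ?E vs" for vs
  proof
    assume c: "cycle_in ?E vs"
    define L where "L = length vs"
    have L: "3 \<le> L" and d: "distinct vs"
      and a: "\<And>k. k < L \<Longrightarrow> adj ?E (vs ! k) (vs ! ((k + 1) mod L))"
      using c by (auto simp: cycle_in_def L_def)
    define pos where "pos k = ?\<tau> (vs ! k)" for k
    have pos_inj: "k = l" if "pos k = pos l" "k < L" "l < L" for k l
    proof -
      have "vs ! k = vs ! l" using that(1) t by (metis pos_def)
      then show ?thesis using that d by (simp add: nth_eq_iff_index_eq L_def)
    qed
    have adj: "pos ((k + 1) mod L) = pos k + 1 \<or> pos k = pos ((k + 1) mod L) + 1" if "k < L" for k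
      using adj_path_edges[OF s, of "pos k" "pos ((k + 1) mod L)"] a[OF that] by (simp add: pos_def t)
    \<comment> \<open>both neighbours of the vertex furthest along the path would be its predecessor\<close>
    obtain k where k: "k < L" and top: "\<And>l. l < L \<Longrightarrow> pos l \<le> pos k"
    proof -
      have "Max (pos ` {..<L}) \<in> pos ` {..<L}" using L by (intro Max_in) (auto simp: lessThan_empty_iff)
      then obtain k where "k < L" "pos k = Max (pos ` {..<L})" by auto
      then show thesis using that[of k] by auto
    qed
    define i where "i = (k + 1) mod L"
    define j where "j = (if k = 0 then L - 1 else k - 1)"
    have i: "i < L" "i = (if k + 1 = L then 0 else k + 1)" using L k by (auto simp: i_def)
    have j: "j < L" "(j + 1) mod L = k" using L k by (auto simp: j_def)
    have "pos k = pos i + 1" using adj[OF k] top[OF i(1)] by (simp add: i_def)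
    moreover have "pos k = pos j + 1" using adj[OF j(1)] top[OF j(1)] by (simp only: j(2)) auto
    ultimately have "i = j" using pos_inj i(1) j(1) by simp
    then show False using i(2) L k by (auto simp: j_def split: if_splits)
  qed
  have deg: "card {v. adj ?E u v} \<le> 2" for u
  proof -
    have "{v. adj ?E u v} \<subseteq> {\<sigma> (?\<tau> u + 1), \<sigma> (?\<tau> u - 1)}"
    proof
      fix v assume "v \<in> {v. adj ?E u v}"
      then have "?\<tau> v = ?\<tau> u + 1 \<or> ?\<tau> u = ?\<tau> v + 1"
        using adj_path_edges[OF s, of "?\<tau> u" "?\<tau> v"] by (simp add: t)
      then show "v \<in> {\<sigma> (?\<tau> u + 1), \<sigma> (?\<tau> u - 1)}"
        using t[of v] by auto
    qed
    then have "card {v. adj ?E u v} \<le> card {\<sigma> (?\<tau> u + 1), \<sigma> (?\<tau> u - 1)}"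
      by (intro card_mono) auto
    also have "\<dots> \<le> 2" by (simp add: card_insert_if)
    finally show ?thesis .
  qed
  show ?thesis using E conn acyc deg by (auto simp: path_on_def tree_on_def)
qed

section \<open>The Bradley--Terry model\<close>

definition spread :: "real \<Rightarrow> real" where
  "spread x = 2 * cosh x + 2"

text \<open>The reciprocal of the intensity is an even function of the difference of the two parameters, growing
with its absolute value. All inequalities between intensities are reduced to this function.\<close>

lemma inverse_intensity: "1 / intensity m \<beta> i j = spread (param m \<beta> i - param m \<beta> j)"
proof -
  have "1 / (exp x / (1 + exp x)\<^sup>2) = 2 * cosh x + 2" for x :: real
    by (simp add: cosh_field_def exp_minus field_simps power2_eq_square)
  then show ?thesis by (simp add: intensity_def spread_def)
qed

lemma spread_pos: "0 < spread x"
  unfolding spread_def using cosh_real_pos[of x] by linarith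

lemma intensity_eq: "intensity m \<beta> i j = 1 / spread (param m \<beta> i - param m \<beta> j)"
  using inverse_intensity[of m \<beta> i j] by (metis div_by_1 divide_divide_eq_right mult_1)

lemma intensity_pos: "0 < intensity m \<beta> i j"
  by (simp add: intensity_eq spread_pos)

lemma intensity_sym: "intensity m \<beta> i j = intensity m \<beta> j i"
proof -
  have "spread (param m \<beta> i - param m \<beta> j) = spread (- (param m \<beta> i - param m \<beta> j))"
    unfolding spread_def cosh_minus ..
  then show ?thesis by (simp add: intensity_eq)
qed

lemma spread_mono: "\<bar>x\<bar> \<le> \<bar>y\<bar> \<Longrightarrow> spread x \<le> spread y"
  using cosh_real_nonneg_le_iff[of "\<bar>x\<bar>" "\<bar>y\<bar>"] by (simp add: spread_def)

text \<open>The difference of two reals on the same side of 0 is no larger in absolute value than one of them.\<close>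

lemma spread_diff_same_side:
  assumes "0 \<le> x \<and> 0 \<le> y \<or> x \<le> 0 \<and> y \<le> 0"
  shows "spread (x - y) < spread x + spread y"
proof (cases "\<bar>x\<bar> \<le> \<bar>y\<bar>")
  case True
  then have "spread (x - y) \<le> spread y" using assms by (intro spread_mono) auto
  then show ?thesis using spread_pos[of x] by simp
next
  case False
  then have "spread (x - y) \<le> spread x" using assms by (intro spread_mono) auto
  then show ?thesis using spread_pos[of y] by simp
qed

definition pair_regr :: "nat \<Rightarrow> nat \<times> nat \<Rightarrow> nat \<Rightarrow> real" where
  "pair_regr m p r = regr m (fst p) (snd p) $ r"

definition pair_intensity :: "nat \<Rightarrow> real vec \<Rightarrow> nat \<times> nat \<Rightarrow> real" where
  "pair_intensity m \<beta> p = intensity m \<beta> (fst p) (snd p)"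

lemma info_mat_eq_gram:
  "info_mat m \<xi> \<beta> = gram (m - 1) (pairs m) (\<lambda>p. \<xi> p * pair_intensity m \<beta> p) (pair_regr m)"
proof -
  have "dim_vec (regr m i j) = m - 1" for i j
    using regr_carrier by (rule carrier_vecD)
  then show ?thesis
    by (intro eq_matI) (auto simp: info_mat_def gram_def outer_self_def pair_intensity_def
      pair_regr_def case_prod_unfold mult.assoc intro!: sum.cong)
qed

lemma log_ext_le_iff: "0 < y \<Longrightarrow> log_ext x \<le> log_ext y \<longleftrightarrow> x \<le> y"
  by (auto simp: log_ext_def)

text \<open>A positive determinant takes the logarithm and its convention at 0 out of the comparison.\<close>

lemma locally_D_optimal_iff_weights:
  assumes \<xi>: "design m \<xi>" and pos: "0 < det (info_mat m \<xi> \<beta>)"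
  shows "locally_D_optimal m \<xi> \<beta> \<longleftrightarrow> (\<forall>w. weights (pairs m) w \<longrightarrow>
    det (gram (m - 1) (pairs m) (\<lambda>p. w p * pair_intensity m \<beta> p) (pair_regr m))
      \<le> det (gram (m - 1) (pairs m) (\<lambda>p. \<xi> p * pair_intensity m \<beta> p) (pair_regr m)))"
proof -
  have "locally_D_optimal m \<xi> \<beta> \<longleftrightarrow>
      (\<forall>\<eta>. design m \<eta> \<longrightarrow> det (info_mat m \<eta> \<beta>) \<le> det (info_mat m \<xi> \<beta>))"
    using \<xi> by (simp add: locally_D_optimal_def log_ext_le_iff[OF pos])
  also have "\<dots> \<longleftrightarrow> (\<forall>w. weights (pairs m) w \<longrightarrow>
    det (gram (m - 1) (pairs m) (\<lambda>p. w p * pair_intensity m \<beta> p) (pair_regr m))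
      \<le> det (info_mat m \<xi> \<beta>))"
  proof (intro iffI allI impI)
    fix w assume opt: "\<forall>\<eta>. design m \<eta> \<longrightarrow> det (info_mat m \<eta> \<beta>) \<le> det (info_mat m \<xi> \<beta>)"
      and w: "weights (pairs m) w"
    define \<eta> where "\<eta> p = (if p \<in> pairs m then w p else 0)" for p
    have "design m \<eta>" using w by (simp add: design_def weights_def \<eta>_def)
    then have "det (info_mat m \<eta> \<beta>) \<le> det (info_mat m \<xi> \<beta>)" using opt by blast
    moreover have "info_mat m \<eta> \<beta>
        = gram (m - 1) (pairs m) (\<lambda>p. w p * pair_intensity m \<beta> p) (pair_regr m)"
      unfolding info_mat_eq_gram by (rule gram_cong) (simp add: \<eta>_def)
    ultimately show "det (gram (m - 1) (pairs m) (\<lambda>p. w p * pair_intensity m \<beta> p) (pair_regr m))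
      \<le> det (info_mat m \<xi> \<beta>)" by simp
  next
    fix \<eta> assume opt: "\<forall>w. weights (pairs m) w \<longrightarrow>
      det (gram (m - 1) (pairs m) (\<lambda>p. w p * pair_intensity m \<beta> p) (pair_regr m))
        \<le> det (info_mat m \<xi> \<beta>)" and "design m \<eta>"
    then show "det (info_mat m \<eta> \<beta>) \<le> det (info_mat m \<xi> \<beta>)"
      by (auto simp: info_mat_eq_gram[of m \<eta>] design_def weights_def)
  qed
  finally show ?thesis by (simp only: info_mat_eq_gram)
qed

lemma saturated_support_design:
  assumes \<xi>: "design m \<xi>" and e: "bij_betw e {..<m - 1} (supp m \<xi>)" and m: "2 \<le> m"
  shows "saturated_support (m - 1) (pairs m) (pair_intensity m \<beta>) e \<xi>"
proof
  show "0 < m - 1" using m by simp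
  have img: "e ` {..<m - 1} = supp m \<xi>" using e by (rule bij_betw_imp_surj_on)
  show "inj_on e {..<m - 1}" using e by (rule bij_betw_imp_inj_on)
  show "0 < pair_intensity m \<beta> p" for p by (simp add: pair_intensity_def intensity_pos)
  show "e k \<in> pairs m" "0 < \<xi> (e k)" if "k < m - 1" for k
  proof -
    have "e k \<in> supp m \<xi>" using img that by blast
    then show "e k \<in> pairs m" "0 < \<xi> (e k)" by (auto simp: supp_def)
  qed
  show "weights (pairs m) \<xi>" using \<xi> by (auto simp: design_def weights_def)
  show "\<xi> p = 0" if "p \<in> pairs m" "p \<notin> e ` {..<m - 1}" for p
    using that \<xi> unfolding img by (auto simp: design_def supp_def less_le)
qed simp

section \<open>Path designs\<close>

lemma regr_entry: "r < m - 1 \<Longrightarrow> regr m i j $ r = unit_of m i $ r - unit_of m j $ r"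
  using carrier_vecD[OF unit_of_carrier[of m j]] by (simp add: regr_def)

text \<open>The sign that reordering the pair \<open>(\<sigma> i, \<sigma> j)\<close> increasingly gives to its regression vector. Only
squares of these signs enter the optimality criterion.\<close>

definition orient :: "(nat \<Rightarrow> nat) \<Rightarrow> nat \<Rightarrow> nat \<Rightarrow> real" where
  "orient \<sigma> i j = (if \<sigma> i < \<sigma> j then 1 else - 1)"

lemma orient_square [simp]: "(orient \<sigma> i j)\<^sup>2 = 1" "orient \<sigma> i j * orient \<sigma> i j = 1"
  by (auto simp: orient_def)

lemma pair_regr_act_pair:
  assumes "r < m - 1"
  shows "pair_regr m (act_pair \<sigma> (i, j)) r
    = orient \<sigma> i j * (unit_of m (\<sigma> i) $ r - unit_of m (\<sigma> j) $ r)"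
  using assms by (auto simp: pair_regr_def act_pair_def orient_def regr_entry min_def max_def)

lemma pair_intensity_act_pair:
  "pair_intensity m \<beta> (act_pair \<sigma> (i, j)) = intensity m \<beta> (\<sigma> i) (\<sigma> j)"
  by (auto simp: pair_intensity_def act_pair_def min_def max_def intensity_sym)

text \<open>The coordinates of the regression vector of \<open>p\<close> in the basis of path edges: with \<open>p\<close> joining the \<open>i\<close>-th
and the \<open>j\<close>-th vertex of the path, \<open>\<plusminus>1\<close> on the edges between them and 0 elsewhere. The \<open>k\<close>-th basis
vector belongs to the edge from vertex \<open>k + 1\<close> to vertex \<open>k + 2\<close>.\<close>

definition path_coeff :: "(nat \<Rightarrow> nat) \<Rightarrow> nat \<times> nat \<Rightarrow> nat \<Rightarrow> real" where
  "path_coeff \<sigma> p k = (case act_pair (inv_into UNIV \<sigma>) p of (i, j) \<Rightarrow>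
     if i \<le> k + 1 \<and> k + 1 < j then orient \<sigma> i j * orient \<sigma> (k + 1) (k + 2) else 0)"

lemma path_coeff_act_pair:
  assumes "\<sigma> permutes {1..m}" "i < j"
  shows "path_coeff \<sigma> (act_pair \<sigma> (i, j)) k =
    (if i \<le> k + 1 \<and> k + 1 < j then orient \<sigma> i j * orient \<sigma> (k + 1) (k + 2) else 0)"
  unfolding path_coeff_def act_pair_inverse(1)[OF assms] by simp

lemma pairs_act_pairE:
  assumes s: "\<sigma> permutes {1..m}" and p: "p \<in> pairs m"
  obtains i j where "p = act_pair \<sigma> (i, j)" "1 \<le> i" "i < j" "j \<le> m"
proof -
  obtain i j where q: "act_pair (inv_into UNIV \<sigma>) p = (i, j)" by fastforce
  have "(i, j) \<in> pairs m" using act_pair_in_pairs[OF permutes_inv[OF s] p] q by simp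
  then have ij: "1 \<le> i" "i < j" "j \<le> m" by (auto simp: pairs_def)
  have "p = act_pair \<sigma> (i, j)"
    using act_pair_inverse(2)[OF s, of "fst p" "snd p"] p by (auto simp: pairs_def q[symmetric])
  with ij that show thesis by blast
qed

lemma sum_path_section:
  fixes g :: "nat \<Rightarrow> real"
  assumes "1 \<le> i" "j \<le> m"
  shows "(\<Sum>k<m - 1. if i \<le> k + 1 \<and> k + 1 < j then g (k + 1) else 0) = (\<Sum>k = i..<j. g k)"
proof -
  have "(\<Sum>k<m - 1. if i \<le> k + 1 \<and> k + 1 < j then g (k + 1) else 0)
      = (\<Sum>k\<in>{k \<in> {..<m - 1}. i \<le> k + 1 \<and> k + 1 < j}. g (k + 1))"
    by (rule sum.inter_filter[symmetric]) simp
  also have "\<dots> = (\<Sum>k = i..<j. g k)"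
    using assms by (intro sum.reindex_bij_witness[of _ "\<lambda>k. k - 1" Suc]) auto
  finally show ?thesis .
qed

text \<open>The regression vectors along the path from \<open>\<sigma> i\<close> to \<open>\<sigma> j\<close> telescope.\<close>

lemma pair_regr_path_coeff:
  assumes s: "\<sigma> permutes {1..m}" and p: "p \<in> pairs m" and r: "r < m - 1"
  shows "pair_regr m p r
    = (\<Sum>k<m - 1. path_coeff \<sigma> p k * pair_regr m (act_pair \<sigma> (k + 1, k + 2)) r)"
proof -
  obtain i j where ij: "p = act_pair \<sigma> (i, j)" "1 \<le> i" "i < j" "j \<le> m"
    using pairs_act_pairE[OF s p] .
  let ?u = "\<lambda>k. unit_of m (\<sigma> k) $ r"
  have "(\<Sum>k<m - 1. path_coeff \<sigma> p k * pair_regr m (act_pair \<sigma> (k + 1, k + 2)) r)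
      = (\<Sum>k<m - 1. if i \<le> k + 1 \<and> k + 1 < j
          then orient \<sigma> i j * (?u (k + 1) - ?u (Suc (k + 1))) else 0)"
  proof (intro sum.cong refl)
    fix k
    have "path_coeff \<sigma> p k * pair_regr m (act_pair \<sigma> (k + 1, k + 2)) r
      = (if i \<le> k + 1 \<and> k + 1 < j then orient \<sigma> i j
          * (orient \<sigma> (k + 1) (k + 2) * orient \<sigma> (k + 1) (k + 2)) * (?u (k + 1) - ?u (k + 2)) else 0)"
      unfolding ij(1) path_coeff_act_pair[OF s ij(3)] pair_regr_act_pair[OF r]
      by (simp only: mult.assoc if_distrib[of "\<lambda>x. x * _"] mult_zero_left)
    then show "path_coeff \<sigma> p k * pair_regr m (act_pair \<sigma> (k + 1, k + 2)) r
      = (if i \<le> k + 1 \<and> k + 1 < j then orient \<sigma> i j * (?u (k + 1) - ?u (Suc (k + 1))) else 0)"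
      by simp
  qed
  also have "\<dots> = (\<Sum>k = i..<j. orient \<sigma> i j * (?u k - ?u (Suc k)))"
    by (rule sum_path_section[OF ij(2,4)])
  also have "\<dots> = orient \<sigma> i j * (?u i - ?u j)"
  proof -
    have "(\<Sum>k = i..<j. ?u k - ?u (Suc k)) = ?u i - ?u j"
      using sum_Suc_diff'[of i j "\<lambda>k. - ?u k"] ij(3) by simp
    then show ?thesis by (simp add: sum_distrib_left[symmetric])
  qed
  also have "\<dots> = pair_regr m p r"
    unfolding ij(1) pair_regr_act_pair[OF r] ..
  finally show ?thesis ..
qed

lemma det_nonzero_if_right_inverse:
  fixes A :: "real mat"
  assumes A: "A \<in> carrier_mat n n"
    and sol: "\<And>r s. r < n \<Longrightarrow> s < n \<Longrightarrow> (\<Sum>k<n. A $$ (r, k) * C k s) = (if r = s then 1 else 0)"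
  shows "det A \<noteq> 0"
proof -
  define B where "B = mat n n (\<lambda>(k, s). C k s)"
  have B: "B \<in> carrier_mat n n" by (simp add: B_def)
  have "A * B = 1\<^sub>m n"
  proof (rule eq_matI)
    fix r s assume rs: "r < dim_row (1\<^sub>m n :: real mat)" "s < dim_col (1\<^sub>m n :: real mat)"
    then have "(A * B) $$ (r, s) = (\<Sum>k<n. A $$ (r, k) * C k s)"
      using A by (simp add: B_def scalar_prod_def lessThan_atLeast0)
    then show "(A * B) $$ (r, s) = 1\<^sub>m n $$ (r, s)" using sol rs by simp
  qed (use A B in auto)
  then have "det A * det B = 1" using det_mult[OF A B] by simp
  then show ?thesis by auto
qed

text \<open>The regression vectors of the pairs \<open>(t + 1, m)\<close> are the unit vectors, so their path coordinates form a
right inverse.\<close>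

lemma det_path_basis:
  assumes s: "\<sigma> permutes {1..m}"
  shows "det (mat (m - 1) (m - 1) (\<lambda>(r, k). pair_regr m (act_pair \<sigma> (k + 1, k + 2)) r)) \<noteq> 0"
proof (rule det_nonzero_if_right_inverse[of _ _ "\<lambda>k t. path_coeff \<sigma> (t + 1, m) k"])
  fix r t assume r: "r < m - 1" and t: "t < m - 1"
  have "(t + 1, m) \<in> pairs m" using t by (auto simp: pairs_def)
  from pair_regr_path_coeff[OF s this r]
  have "(\<Sum>k<m - 1. pair_regr m (act_pair \<sigma> (k + 1, k + 2)) r * path_coeff \<sigma> (t + 1, m) k)
      = pair_regr m (t + 1, m) r"
    by (simp add: mult.commute)
  also have "\<dots> = (if r = t then 1 else 0)"
    using r t regr_unit[of "t + 1" m] by (auto simp: pair_regr_def)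
  finally show "(\<Sum>k<m - 1. mat (m - 1) (m - 1)
      (\<lambda>(r, k). pair_regr m (act_pair \<sigma> (k + 1, k + 2)) r) $$ (r, k) * path_coeff \<sigma> (t + 1, m) k)
      = (if r = t then 1 else 0)"
    using r by simp
qed simp

lemma act_design_path:
  assumes s: "\<sigma> permutes {1..m}"
  shows "act_design m \<sigma> (path_design0 m) = uniform_on m (path_edges m \<sigma>)"
proof
  fix p
  show "act_design m \<sigma> (path_design0 m) p = uniform_on m (path_edges m \<sigma>) p"
  proof (cases "p \<in> pairs m")
    case True
    then obtain i j where ij: "p = act_pair \<sigma> (i, j)" "1 \<le> i" "i < j" "j \<le> m"
      using pairs_act_pairE[OF s] by blast
    have "p \<in> path_edges m \<sigma> \<longleftrightarrow> j = i + 1"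
    proof
      assume "p \<in> path_edges m \<sigma>"
      then obtain k where "act_pair \<sigma> (i, j) = act_pair \<sigma> (k, k + 1)"
        by (auto simp: path_edges_def ij(1))
      then have "(i, j) = (k, k + 1)"
        using act_pair_inverse(1)[OF s, of i j] act_pair_inverse(1)[OF s, of k "k + 1"] ij(3) by simp
      then show "j = i + 1" by simp
    qed (use ij in \<open>auto simp: path_edges_def\<close>)
    moreover have "act_design m \<sigma> (path_design0 m) p = path_design0 m (i, j)"
      using True act_pair_inverse(1)[OF s ij(3)] by (simp add: act_design_def ij(1))
    ultimately show ?thesis using ij by (simp add: uniform_on_def path_design0_def)
  next
    case False
    then show ?thesis using path_edges_subset[OF s] by (auto simp: act_design_def uniform_on_def)
  qed
qed

lemma supp_uniform_on:
  assumes "E \<subseteq> pairs m" "2 \<le> m"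
  shows "supp m (uniform_on m E) = E"
  using assms by (auto simp: supp_def uniform_on_def)

lemma design_uniform_on:
  assumes E: "E \<subseteq> pairs m" and c: "card E = m - 1" and m: "2 \<le> m"
  shows "design m (uniform_on m E)"
proof -
  have "(\<Sum>p\<in>pairs m. uniform_on m E p) = (\<Sum>p\<in>E. 1 / (real m - 1))"
    unfolding uniform_on_def using E by (simp add: sum.If_cases Int_absorb1)
  also have "\<dots> = 1" using m by (simp add: c of_nat_diff)
  finally show ?thesis using E m by (auto simp: design_def uniform_on_def)
qed

lemma path_design:
  assumes "\<sigma> permutes {1..m}" "2 \<le> m"
  shows "design m (uniform_on m (path_edges m \<sigma>))"
    "supp m (uniform_on m (path_edges m \<sigma>)) = path_edges m \<sigma>"
    "saturated m (uniform_on m (path_edges m \<sigma>))"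
  using assms path_edges_subset card_path_edges
  by (auto simp: saturated_def supp_uniform_on design_uniform_on)

lemma path_saturated_support:
  assumes s: "\<sigma> permutes {1..m}" and m: "2 \<le> m"
  shows "saturated_support (m - 1) (pairs m) (pair_intensity m \<beta>)
    (\<lambda>k. act_pair \<sigma> (k + 1, k + 2)) (uniform_on m (path_edges m \<sigma>))"
  using path_design[OF s m] path_edges_enum[OF s] m by (intro saturated_support_design) auto

lemma det_info_mat_path_pos:
  assumes s: "\<sigma> permutes {1..m}" and m: "2 \<le> m"
  shows "0 < det (info_mat m (uniform_on m (path_edges m \<sigma>)) \<beta>)"
proof -
  interpret saturated_support "m - 1" "pairs m" "pair_regr m" "pair_intensity m \<beta>"
    "\<lambda>k. act_pair \<sigma> (k + 1, k + 2)" "uniform_on m (path_edges m \<sigma>)"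
    by (rule path_saturated_support[OF s m])
  have "det F \<noteq> 0" unfolding F_def by (rule det_path_basis[OF s])
  then have "0 < det (M (uniform_on m (path_edges m \<sigma>)))"
    unfolding det_M_support using w_pos lam_pos e_P by (intro mult_pos_pos prod_pos) auto
  then show ?thesis unfolding M_def info_mat_eq_gram .
qed

lemma path_design_optimal_iff:
  assumes s: "\<sigma> permutes {1..m}" and m: "2 \<le> m"
  shows "locally_D_optimal m (uniform_on m (path_edges m \<sigma>)) \<beta> \<longleftrightarrow>
    (\<forall>i j. 1 \<le> i \<and> i < j \<and> j \<le> m \<longrightarrow>
      intensity m \<beta> (\<sigma> i) (\<sigma> j) * (\<Sum>k = i..<j. 1 / intensity m \<beta> (\<sigma> k) (\<sigma> (k + 1))) \<le> 1)"
    (is "?opt \<longleftrightarrow> (\<forall>i j. ?ij i j \<longrightarrow> ?ineq i j)")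
proof -
  interpret saturated_support "m - 1" "pairs m" "pair_regr m" "pair_intensity m \<beta>"
    "\<lambda>k. act_pair \<sigma> (k + 1, k + 2)" "uniform_on m (path_edges m \<sigma>)"
    by (rule path_saturated_support[OF s m])
  let ?c = "path_coeff \<sigma>"
  let ?e = "\<lambda>k. act_pair \<sigma> (k + 1, k + 2)"
  have F: "det F \<noteq> 0" unfolding F_def by (rule det_path_basis[OF s])
  have unif: "uniform_on m (path_edges m \<sigma>) (?e k) = 1 / real (m - 1)" if "k < m - 1" for k
  proof -
    have "?e k \<in> path_edges m \<sigma>"
      using bij_betw_imp_surj_on[OF path_edges_enum[OF s]] that by blast
    then show ?thesis using m by (simp add: uniform_on_def of_nat_diff)
  qed
  have sec: "(\<Sum>k<m - 1. (?c (act_pair \<sigma> (i, j)) k)\<^sup>2 / pair_intensity m \<beta> (?e k))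
      = (\<Sum>k = i..<j. 1 / intensity m \<beta> (\<sigma> k) (\<sigma> (k + 1)))" if "?ij i j" for i j
  proof -
    have ij: "i < j" using that by simp
    have "(\<Sum>k<m - 1. (?c (act_pair \<sigma> (i, j)) k)\<^sup>2 / pair_intensity m \<beta> (?e k))
      = (\<Sum>k<m - 1. if i \<le> k + 1 \<and> k + 1 < j
          then 1 / intensity m \<beta> (\<sigma> (k + 1)) (\<sigma> ((k + 1) + 1)) else 0)"
      unfolding path_coeff_act_pair[OF s ij] pair_intensity_act_pair
      by (intro sum.cong refl) (simp add: power_mult_distrib)
    also have "\<dots> = (\<Sum>k = i..<j. 1 / intensity m \<beta> (\<sigma> k) (\<sigma> (k + 1)))"
      using that sum_path_section[of i j m "\<lambda>k. 1 / intensity m \<beta> (\<sigma> k) (\<sigma> (k + 1))"] by simp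
    finally show ?thesis .
  qed
  have "?opt \<longleftrightarrow> (\<forall>p\<in>pairs m. pair_intensity m \<beta> p
      * (\<Sum>k<m - 1. (?c p k)\<^sup>2 / pair_intensity m \<beta> (?e k)) \<le> 1)"
    unfolding locally_D_optimal_iff_weights[OF path_design(1)[OF s m] det_info_mat_path_pos[OF s m]]
    using optimal_iff[OF F pair_regr_path_coeff[OF s], unfolded M_def] unif by simp
  also have "\<dots> \<longleftrightarrow> (\<forall>i j. ?ij i j \<longrightarrow> ?ineq i j)"
  proof (intro iffI allI impI ballI)
    fix i j assume A: "\<forall>p\<in>pairs m. pair_intensity m \<beta> p
      * (\<Sum>k<m - 1. (?c p k)\<^sup>2 / pair_intensity m \<beta> (?e k)) \<le> 1" and ij: "?ij i j"
    have "act_pair \<sigma> (i, j) \<in> pairs m"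
      using act_pair_in_pairs[OF s, of "(i, j)"] ij by (simp add: pairs_def)
    then show "?ineq i j" using A sec[OF ij] by (auto simp: pair_intensity_act_pair)
  next
    fix p assume A: "\<forall>i j. ?ij i j \<longrightarrow> ?ineq i j" and "p \<in> pairs m"
    from pairs_act_pairE[OF s this(2)]
    obtain i j where p: "p = act_pair \<sigma> (i, j)" and "1 \<le> i" "i < j" "j \<le> m" .
    then have ij: "?ij i j" by simp
    show "pair_intensity m \<beta> p
      * (\<Sum>k<m - 1. (?c p k)\<^sup>2 / pair_intensity m \<beta> (?e k)) \<le> 1"
      unfolding p sec[OF ij] unfolding pair_intensity_act_pair by (rule A[rule_format, OF ij])
  qed
  finally show ?thesis .
qed

section \<open>Optimal saturated designs are path designs\<close>

lemma sum_two_indices: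
  fixes A B :: real and k l n :: nat
  assumes "k \<noteq> l" "k < n" "l < n"
  shows "(\<Sum>i<n. if i = k then A else if i = l then B else 0) = A + B"
proof -
  have "(\<Sum>i<n. if i = k then A else if i = l then B else 0)
      = (\<Sum>i<n. (if i = k then A else 0) + (if i = l then B else 0))"
    using assms(1) by (intro sum.cong) auto
  also have "\<dots> = A + B" using assms(2,3) by (simp add: sum.distrib)
  finally show ?thesis .
qed

text \<open>Pairing with a vector of \<open>m - 1\<close> coordinates reads off a function on the alternatives that vanishes
at \<open>m\<close>.\<close>

lemma sum_unit_of:
  assumes "i \<in> {1..m}"
  shows "(\<Sum>r<m - 1. unit_of m i $ r * g (r + 1)) = (if i = m then 0 else g i)"
proof (cases "i = m")
  case True
  then show ?thesis by (simp add: unit_of_def)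
next
  case False
  have "(\<Sum>r<m - 1. unit_of m i $ r * g (r + 1)) = (\<Sum>r<m - 1. if r = i - 1 then g i else 0)"
    using assms False by (intro sum.cong) (auto simp: unit_of_def unit_vec_def)
  then show ?thesis using assms False by auto
qed

text \<open>An optimal design is at least as good as the path design on \<open>1, \<dots>, m\<close>, which is nonsingular.\<close>

lemma optimal_det_pos:
  assumes opt: "locally_D_optimal m \<xi> \<beta>" and m: "2 \<le> m"
  shows "0 < det (info_mat m \<xi> \<beta>)"
proof -
  let ?\<eta> = "uniform_on m (path_edges m id)"
  have "log_ext (det (info_mat m ?\<eta> \<beta>)) \<le> log_ext (det (info_mat m \<xi> \<beta>))"
    using opt path_design(1)[OF permutes_id m] by (auto simp: locally_D_optimal_def)
  then show ?thesis
    using det_info_mat_path_pos[OF permutes_id m, of \<beta>] by (auto simp: log_ext_def split: if_splits)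
qed

text \<open>The support is a graph with \<open>m - 1\<close> edges. It is connected, because the indicator vector of the
alternatives not connected to \<open>m\<close> is orthogonal to all regression vectors of the support, which form
a basis. No alternative \<open>a\<close> has three neighbours: if \<open>b\<close> and \<open>c\<close> are neighbours of \<open>a\<close>, the optimality
condition for the pair \<open>b, c\<close>, whose regression vector is a combination of those of the two edges,
forces the parameters of \<open>b\<close> and \<open>c\<close> to lie strictly on opposite sides of that of \<open>a\<close>; among three
neighbours, two are on the same side.\<close>

lemma saturated_optimal_imp_path:
  assumes m: "2 \<le> m" and sat: "saturated m \<xi>" and opt: "locally_D_optimal m \<xi> \<beta>"
  obtains \<sigma> where "\<sigma> permutes {1..m}" "\<xi> = uniform_on m (path_edges m \<sigma>)"
proof -
  define E where "E = supp m \<xi>"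
  have \<xi>: "design m \<xi>" using opt by (simp add: locally_D_optimal_def)
  have E: "E \<subseteq> pairs m" by (auto simp: E_def supp_def)
  have finE: "finite E" using E finite_pairs by (rule finite_subset)
  have cardE: "card E = m - 1" using sat by (simp add: saturated_def E_def)
  obtain e where e: "bij_betw e {..<m - 1} E"
    using ex_bij_betw_nat_finite[OF finE] unfolding cardE atLeast0LessThan by blast
  interpret saturated_support "m - 1" "pairs m" "pair_regr m" "pair_intensity m \<beta>" e \<xi>
    using saturated_support_design[OF \<xi> _ m] e by (simp only: E_def)
  have imgE: "e ` {..<m - 1} = E" using e by (rule bij_betw_imp_surj_on)
  have "0 < det (M \<xi>)"
    using optimal_det_pos[OF opt m] unfolding M_def info_mat_eq_gram .
  then have F: "det F \<noteq> 0" unfolding det_M_support by auto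
  have optM: "det (M w') \<le> det (M \<xi>)" if "weights (pairs m) w'" for w'
    using locally_D_optimal_iff_weights[OF \<xi> optimal_det_pos[OF opt m]] opt that
    unfolding M_def by blast

  \<comment> \<open>the optimality condition for the pair of two neighbours \<open>b\<close> and \<open>c\<close> of \<open>a\<close>\<close>
  have two: "spread (param m \<beta> a - param m \<beta> b) + spread (param m \<beta> a - param m \<beta> c)
      \<le> spread ((param m \<beta> a - param m \<beta> b) - (param m \<beta> a - param m \<beta> c))"
    if ab: "adj E a b" and ac: "adj E a c" and bc: "b \<noteq> c" for a b c
  proof -
    have r: "a \<in> {1..m}" "b \<in> {1..m}" "c \<in> {1..m}" "a \<noteq> b" "a \<noteq> c"
      using adj_range[OF E ab] adj_range[OF E ac] by auto
    have "act_pair id (a, b) \<in> E" "act_pair id (a, c) \<in> E"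
      using adj_iff_act_pair[OF E, of id] ab ac r by auto
    then obtain k l where k: "k < m - 1" "e k = act_pair id (a, b)"
      and l: "l < m - 1" "e l = act_pair id (a, c)"
      unfolding imgE[symmetric] by (auto simp del: One_nat_def)
    have kl: "k \<noteq> l"
      using k l bc r by (auto simp: act_pair_def min_def max_def split: if_splits)
    have q: "act_pair id (c, b) \<in> pairs m"
      using r bc by (auto simp: act_pair_def pairs_def min_def max_def)
    define co where "co i = (if i = k then orient id c b * orient id a b
      else if i = l then - orient id c b * orient id a c else 0)" for i
    have "pair_regr m (act_pair id (c, b)) s = (\<Sum>i<m - 1. co i * pair_regr m (e i) s)"
      if s: "s < m - 1" for s
    proof -
      have "(\<Sum>i<m - 1. co i * pair_regr m (e i) s)
        = (\<Sum>i<m - 1. if i = k then orient id c b * (orient id a b * pair_regr m (e k) s)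
            else if i = l then - orient id c b * (orient id a c * pair_regr m (e l) s) else 0)"
        by (intro sum.cong) (auto simp: co_def)
      also have "\<dots> = orient id c b * (orient id a b * pair_regr m (e k) s)
          + - orient id c b * (orient id a c * pair_regr m (e l) s)"
        by (rule sum_two_indices[OF kl k(1) l(1)])
      also have "\<dots> = orient id c b * ((orient id a b * orient id a b) * (unit_of m a $ s - unit_of m b $ s))
          + - orient id c b * ((orient id a c * orient id a c) * (unit_of m a $ s - unit_of m c $ s))"
        by (simp only: k(2) l(2) pair_regr_act_pair[OF s] mult.assoc id_apply)
      also have "\<dots> = pair_regr m (act_pair id (c, b)) s"
        unfolding pair_regr_act_pair[OF s] by (simp add: algebra_simps)
      finally show ?thesis ..
    qed
    from optimal_sum_le[OF optM F q this]
    have "pair_intensity m \<beta> (act_pair id (c, b))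
      * (\<Sum>i<m - 1. (co i)\<^sup>2 / pair_intensity m \<beta> (e i)) \<le> 1" .
    also have "(\<Sum>i<m - 1. (co i)\<^sup>2 / pair_intensity m \<beta> (e i))
      = (\<Sum>i<m - 1. if i = k then 1 / pair_intensity m \<beta> (e k)
          else if i = l then 1 / pair_intensity m \<beta> (e l) else 0)"
      by (intro sum.cong) (auto simp: co_def power_mult_distrib)
    also have "\<dots> = 1 / pair_intensity m \<beta> (e k) + 1 / pair_intensity m \<beta> (e l)"
      by (rule sum_two_indices[OF kl k(1) l(1)])
    finally have "(spread (param m \<beta> a - param m \<beta> b) + spread (param m \<beta> a - param m \<beta> c))
      / spread (param m \<beta> c - param m \<beta> b) \<le> 1"
      by (simp add: k(2) l(2) pair_intensity_act_pair intensity_eq)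
    then show ?thesis
      using spread_pos[of "param m \<beta> c - param m \<beta> b"] by (simp add: divide_le_eq)
  qed
  have deg: "card {v. adj E u v} \<le> 2" for u
  proof (rule ccontr)
    assume "\<not> ?thesis"
    then have "3 \<le> card {v. adj E u v}" by simp
    then obtain T where T: "T \<subseteq> {v. adj E u v}" "card T = 3"
      by (rule obtain_subset_with_card_n)
    then obtain b c d where bcd: "T = {b, c, d}" "b \<noteq> c" "c \<noteq> d" "b \<noteq> d"
      by (auto simp: card_3_iff)
    have a: "adj E u b" "adj E u c" "adj E u d" using T bcd by auto
    let ?x = "\<lambda>v. param m \<beta> u - param m \<beta> v"
    have opposite: "\<not> (0 \<le> ?x v \<and> 0 \<le> ?x w \<or> ?x v \<le> 0 \<and> ?x w \<le> 0)"
      if "adj E u v" "adj E u w" "v \<noteq> w" for v w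
      using two[OF that] spread_diff_same_side[of "?x v" "?x w"] by linarith
    show False
      using opposite[OF a(1,2) bcd(2)] opposite[OF a(2,3) bcd(3)] opposite[OF a(1,3) bcd(4)]
      by linarith
  qed
  have conn_m: "(adj E)\<^sup>*\<^sup>* u m" if u: "u \<in> {1..m}" for u
  proof (rule ccontr)
    assume not: "\<not> ?thesis"
    define g :: "nat \<Rightarrow> real" where "g i = (if (adj E)\<^sup>*\<^sup>* i m then 0 else 1)" for i
    define x where "x = vec (m - 1) (\<lambda>r. g (r + 1))"
    have gm: "g m = 0" by (simp add: g_def)
    have "transpose_mat F *\<^sub>v x = 0\<^sub>v (m - 1)"
    proof (rule eq_vecI)
      fix k assume "k < dim_vec (0\<^sub>v (m - 1) :: real vec)"
      then have k: "k < m - 1" by simp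
      obtain i j where ij: "e k = (i, j)" by fastforce
      have "e k \<in> E" using imgE k by blast
      then have adj: "adj E i j" by (simp add: ij adj_def)
      have r: "i \<in> {1..m}" "j \<in> {1..m}" using adj_range[OF E adj] by auto
      have "(transpose_mat F *\<^sub>v x) $ k = (\<Sum>r<m - 1. pair_regr m (e k) r * g (r + 1))"
        using k unfolding F_def x_def by (simp add: scalar_prod_def lessThan_atLeast0)
      also have "\<dots> = (\<Sum>r<m - 1. unit_of m i $ r * g (r + 1)) - (\<Sum>r<m - 1. unit_of m j $ r * g (r + 1))"
        unfolding sum_subtractf[symmetric]
        by (intro sum.cong) (auto simp: pair_regr_def ij regr_entry algebra_simps)
      also have "\<dots> = g i - g j"
        using sum_unit_of[OF r(1), of g] sum_unit_of[OF r(2), of g] gm by auto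
      also have "\<dots> = 0"
        using adj adj_sym[OF adj] unfolding g_def by (auto intro: converse_rtranclp_into_rtranclp)
      finally show "(transpose_mat F *\<^sub>v x) $ k = 0\<^sub>v (m - 1) $ k" using k by simp
    qed (use F_carrier in auto)
    moreover have "x \<noteq> 0\<^sub>v (m - 1)"
    proof
      assume x: "x = 0\<^sub>v (m - 1)"
      have "u \<noteq> m" using not by auto
      then have u': "u - 1 < m - 1" "(u - 1) + 1 = u" using u by auto
      have "x $ (u - 1) = 1" using u' not by (simp add: x_def g_def del: One_nat_def)
      then show False using u'(1) by (simp add: x)
    qed
    moreover have "x \<in> carrier_vec (m - 1)" by (simp add: x_def)
    ultimately have "det (transpose_mat F) = 0"
      using det_0_iff_vec_prod_zero[of "transpose_mat F" "m - 1"] F_carrier by auto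
    then show False using F det_transpose[OF F_carrier] by simp
  qed
  have "symp (adj E)" by (auto intro: sympI adj_sym)
  then have "symp (adj E)\<^sup>*\<^sup>*" by (rule symp_rtranclp)
  then have conn: "(adj E)\<^sup>*\<^sup>* u v" if "u \<in> {1..m}" "v \<in> {1..m}" for u v
    using conn_m[OF that(1)] conn_m[OF that(2)] by (meson rtranclp_trans sympD)
  have "1 \<le> m" using m by simp
  then obtain \<sigma> where s: "\<sigma> permutes {1..m}" and sub: "path_edges m \<sigma> \<subseteq> E"
    using Hamiltonian_path_if_degree_le_2[OF E _ conn deg] by blast
  have EE: "path_edges m \<sigma> = E"
    using sub finE cardE card_path_edges[OF s] by (intro card_subset_eq) auto
  have "\<xi> = uniform_on m E"
  proof
    fix p
    consider k where "k < m - 1" "p = e k" | "p \<in> pairs m" "p \<notin> E" | "p \<notin> pairs m"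
      using imgE by blast
    then show "\<xi> p = uniform_on m E p"
    proof cases
      case 1
      then have "p \<in> E" using imgE by blast
      then show ?thesis
        using optimal_imp_uniform[OF optM F 1(1)] 1(2) m by (simp add: uniform_on_def of_nat_diff)
    next
      case 2
      then show ?thesis using w_zero[of p] imgE by (simp add: uniform_on_def)
    next
      case 3
      then have "\<xi> p = 0" "p \<notin> E" using \<xi> E unfolding design_def by blast+
      then show ?thesis by (simp add: uniform_on_def)
    qed
  qed
  with s EE that show thesis by blast
qed

section \<open>Every path design is optimal somewhere\<close>

text \<open>By the addition theorem it is enough that \<open>(cosh x - 1) (cosh y - 1) \<ge> 2\<close>.\<close>

lemma spread_superadditive:
  assumes "0 \<le> x" "0 \<le> y" "3 \<le> cosh x" "3 \<le> cosh y"
  shows "spread x + spread y \<le> spread (x + y)"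
proof -
  have "2 * 2 \<le> (cosh x - 1) * (cosh y - 1)"
    using assms by (intro mult_mono) auto
  moreover have "0 \<le> sinh x * sinh y" using assms by simp
  ultimately show ?thesis by (simp add: spread_def cosh_add algebra_simps)
qed

lemma spread_multiple:
  assumes t: "0 \<le> t" "3 \<le> cosh t" and d: "1 \<le> d"
  shows "real d * spread t \<le> spread (real d * t)"
  using d
proof (induction d rule: dec_induct)
  case base
  show ?case by simp
next
  case (step d)
  have "t \<le> real d * t" using step(1) t(1) by (simp add: mult_le_cancel_right1)
  then have "cosh t \<le> cosh (real d * t)"
    using t(1) by (subst cosh_real_nonneg_le_iff) auto
  then have "spread (real d * t) + spread t \<le> spread (real d * t + t)"
    using t by (intro spread_superadditive) auto
  then show ?case using step.IH by (simp add: algebra_simps)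
qed

text \<open>Equally spaced parameters along the path work as soon as the spacing \<open>t\<close> is large: then the condition
for the \<open>i\<close>-th and \<open>j\<close>-th vertex is \<open>(j - i) spread t \<le> spread ((j - i) t)\<close>.\<close>

lemma path_design_optimal_somewhere:
  assumes s: "\<sigma> permutes {1..m}" and m: "2 \<le> m"
  shows "\<exists>\<beta>\<in>carrier_vec (m - 1). locally_D_optimal m (uniform_on m (path_edges m \<sigma>)) \<beta>"
proof
  let ?\<tau> = "inv_into UNIV \<sigma>"
  define t where "t = arcosh (3 :: real)"
  have t: "0 \<le> t" "3 \<le> cosh t" by (auto simp: t_def)
  \<comment> \<open>shifted so that alternative \<open>m\<close> has parameter 0\<close>
  define \<beta> where "\<beta> = vec (m - 1) (\<lambda>r. t * (real (?\<tau> m) - real (?\<tau> (r + 1))))"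
  show "\<beta> \<in> carrier_vec (m - 1)" by (simp add: \<beta>_def)
  have par: "param m \<beta> u = t * (real (?\<tau> m) - real (?\<tau> u))" if "u \<in> {1..m}" for u
    using that by (auto simp: param_def \<beta>_def)
  have int: "intensity m \<beta> (\<sigma> i) (\<sigma> j) = 1 / spread (real (j - i) * t)"
    if "1 \<le> i" "i \<le> j" "j \<le> m" for i j
  proof -
    have "\<sigma> i \<in> {1..m}" "\<sigma> j \<in> {1..m}" using permutes_in_image[OF s] that by auto
    then have "param m \<beta> (\<sigma> i) - param m \<beta> (\<sigma> j) = real (j - i) * t"
      using that by (simp add: par permutes_inverses(2)[OF s] of_nat_diff algebra_simps)
    then show ?thesis by (simp add: intensity_eq)
  qed
  show "locally_D_optimal m (uniform_on m (path_edges m \<sigma>)) \<beta>"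
    unfolding path_design_optimal_iff[OF s m]
  proof (intro allI impI)
    fix i j assume ij: "1 \<le> i \<and> i < j \<and> j \<le> m"
    have "(\<Sum>k = i..<j. 1 / intensity m \<beta> (\<sigma> k) (\<sigma> (k + 1))) = (\<Sum>k = i..<j. spread t)"
      using ij by (intro sum.cong refl) (subst int, auto)
    also have "\<dots> \<le> spread (real (j - i) * t)"
    proof -
      have "1 \<le> j - i" using ij by linarith
      from spread_multiple[OF t this] show ?thesis using ij by simp
    qed
    finally have "(\<Sum>k = i..<j. 1 / intensity m \<beta> (\<sigma> k) (\<sigma> (k + 1))) / spread (real (j - i) * t) \<le> 1"
      using spread_pos by (simp add: divide_le_eq)
    then show "intensity m \<beta> (\<sigma> i) (\<sigma> j) * (\<Sum>k = i..<j. 1 / intensity m \<beta> (\<sigma> k) (\<sigma> (k + 1))) \<le> 1"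
      using int[of i j] ij by simp
  qed
qed

section \<open>Regions of optimality and the action of the symmetric group\<close>

lemma param_eq_scalar_prod:
  assumes "\<beta> \<in> carrier_vec (m - 1)" "i \<in> {1..m}"
  shows "param m \<beta> i = \<beta> \<bullet> unit_of m i"
  using assms by (auto simp: param_def unit_of_def)

lemma param_diff_eq_scalar_prod:
  assumes b: "\<beta> \<in> carrier_vec (m - 1)" and ij: "i \<in> {1..m}" "j \<in> {1..m}"
  shows "param m \<beta> i - param m \<beta> j = \<beta> \<bullet> regr m i j"
  unfolding regr_def param_eq_scalar_prod[OF b ij(1)] param_eq_scalar_prod[OF b ij(2)]
  using b by (subst scalar_prod_minus_distrib[of _ "m - 1"]) (auto simp del: One_nat_def)

lemma inv_transpose_carrier:
  assumes s: "\<sigma> permutes {1..m}" and b: "\<beta> \<in> carrier_vec (m - 1)"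
  shows "inv_transpose (Q_mat m \<sigma>) *\<^sub>v \<beta> \<in> carrier_vec (m - 1)"
proof -
  obtain B where B: "mat_inverse (Q_mat m \<sigma>) = Some B" "B \<in> carrier_mat (m - 1) (m - 1)"
    using Q_mat_inverse[OF s] by metis
  then have it: "inv_transpose (Q_mat m \<sigma>) = transpose_mat B" by (simp add: inv_transpose_def)
  show ?thesis
    unfolding it using B(2) b by (intro mult_mat_vec_carrier[of _ "m - 1" "m - 1"]) auto
qed

text \<open>The intensity depends on \<open>\<beta>\<close> through \<open>\<beta> \<bullet> regr m i j\<close>, and the inverse transpose is adjoint to the
inverse, which takes \<open>regr m (\<sigma> i) (\<sigma> j)\<close> back to \<open>regr m i j\<close>.\<close>

lemma intensity_inv_transpose:
  assumes s: "\<sigma> permutes {1..m}" and b: "\<beta> \<in> carrier_vec (m - 1)" and ij: "i \<in> {1..m}" "j \<in> {1..m}"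
  shows "intensity m (inv_transpose (Q_mat m \<sigma>) *\<^sub>v \<beta>) (\<sigma> i) (\<sigma> j) = intensity m \<beta> i j"
proof -
  obtain B where B: "mat_inverse (Q_mat m \<sigma>) = Some B" "B \<in> carrier_mat (m - 1) (m - 1)"
    "B * Q_mat m \<sigma> = 1\<^sub>m (m - 1)"
    using Q_mat_inverse[OF s] by metis
  have Q: "Q_mat m \<sigma> \<in> carrier_mat (m - 1) (m - 1)"
    "regr m (\<sigma> i) (\<sigma> j) = Q_mat m \<sigma> *\<^sub>v regr m i j"
    using theI'[OF Q_mat_unique[OF s]] ij unfolding Q_mat_def by blast+
  have it: "inv_transpose (Q_mat m \<sigma>) = transpose_mat B" by (simp add: inv_transpose_def B(1))
  note c = inv_transpose_carrier[OF s b]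
  have r: "\<sigma> i \<in> {1..m}" "\<sigma> j \<in> {1..m}" using permutes_in_image[OF s] ij by blast+
  have "param m (inv_transpose (Q_mat m \<sigma>) *\<^sub>v \<beta>) (\<sigma> i)
      - param m (inv_transpose (Q_mat m \<sigma>) *\<^sub>v \<beta>) (\<sigma> j)
      = (transpose_mat B *\<^sub>v \<beta>) \<bullet> (Q_mat m \<sigma> *\<^sub>v regr m i j)"
    unfolding param_diff_eq_scalar_prod[OF c r] Q(2) unfolding it ..
  also have "\<dots> = \<beta> \<bullet> (B *\<^sub>v (Q_mat m \<sigma> *\<^sub>v regr m i j))"
    by (rule transpose_vec_mult_scalar[OF B(2) mult_mat_vec_carrier[OF Q(1) regr_carrier] b])
  also have "B *\<^sub>v (Q_mat m \<sigma> *\<^sub>v regr m i j) = (B * Q_mat m \<sigma>) *\<^sub>v regr m i j"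
    by (rule assoc_mult_mat_vec[OF B(2) Q(1) regr_carrier, symmetric])
  also have "\<dots> = regr m i j" unfolding B(3) by (rule one_mult_mat_vec[OF regr_carrier])
  also have "\<beta> \<bullet> regr m i j = param m \<beta> i - param m \<beta> j"
    by (rule param_diff_eq_scalar_prod[OF b ij, symmetric])
  finally show ?thesis
    by (simp add: intensity_eq)
qed

lemma inv_transpose_surj:
  assumes s: "\<sigma> permutes {1..m}" and b: "\<beta> \<in> carrier_vec (m - 1)"
  obtains \<gamma> where "\<gamma> \<in> carrier_vec (m - 1)" "\<beta> = inv_transpose (Q_mat m \<sigma>) *\<^sub>v \<gamma>"
proof -
  obtain B where B: "mat_inverse (Q_mat m \<sigma>) = Some B" "B \<in> carrier_mat (m - 1) (m - 1)"
    "Q_mat m \<sigma> * B = 1\<^sub>m (m - 1)"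
    using Q_mat_inverse[OF s] by metis
  have Q: "Q_mat m \<sigma> \<in> carrier_mat (m - 1) (m - 1)"
    using theI'[OF Q_mat_unique[OF s]] unfolding Q_mat_def by blast
  let ?\<gamma> = "transpose_mat (Q_mat m \<sigma>) *\<^sub>v \<beta>"
  have "transpose_mat B *\<^sub>v ?\<gamma> = (transpose_mat B * transpose_mat (Q_mat m \<sigma>)) *\<^sub>v \<beta>"
    using B(2) Q b by (intro assoc_mult_mat_vec[symmetric]) auto
  also have "transpose_mat B * transpose_mat (Q_mat m \<sigma>) = transpose_mat (Q_mat m \<sigma> * B)"
    using B(2) Q by (simp add: transpose_mult[of _ "m - 1" "m - 1" _ "m - 1"])
  also have "transpose_mat (Q_mat m \<sigma> * B) *\<^sub>v \<beta> = \<beta>"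
    unfolding B(3) transpose_one using b by (rule one_mult_mat_vec)
  finally have "\<beta> = inv_transpose (Q_mat m \<sigma>) *\<^sub>v ?\<gamma>"
    by (simp add: inv_transpose_def B(1))
  moreover have "?\<gamma> \<in> carrier_vec (m - 1)"
    using Q b by (intro mult_mat_vec_carrier[of _ "m - 1" "m - 1"]) auto
  ultimately show thesis using that by blast
qed

lemma region_path:
  assumes s: "\<sigma> permutes {1..m}" and m: "2 \<le> m"
  shows "region m (act_design m \<sigma> (path_design0 m))
    = {\<beta> \<in> carrier_vec (m - 1). \<forall>i j. 1 \<le> i \<and> i < j \<and> j \<le> m \<longrightarrow>
        intensity m \<beta> (\<sigma> i) (\<sigma> j) * (\<Sum>k = i..<j. 1 / intensity m \<beta> (\<sigma> k) (\<sigma> (k + 1))) \<le> 1}"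
  unfolding region_def act_design_path[OF s] path_design_optimal_iff[OF s m] ..

lemma region_path0:
  assumes m: "2 \<le> m"
  shows "region m (path_design0 m) = {\<beta> \<in> carrier_vec (m - 1). \<forall>i j. 1 \<le> i \<and> i < j \<and> j \<le> m \<longrightarrow>
    intensity m \<beta> i j * (\<Sum>k = i..<j. 1 / intensity m \<beta> k (k + 1)) \<le> 1}"
proof -
  have "path_design0 m = act_design m id (path_design0 m)"
    by (auto simp: act_design_def act_pair_def path_design0_def pairs_def fun_eq_iff min_def max_def)
  then show ?thesis using region_path[OF permutes_id m] by simp
qed

text \<open>The inequalities that describe the two regions correspond to each other term by term under
\<open>intensity_inv_transpose\<close>.\<close>

lemma region_orbit:
  assumes s: "\<sigma> permutes {1..m}" and m: "2 \<le> m"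
  shows "region m (act_design m \<sigma> (path_design0 m))
    = (\<lambda>\<beta>. inv_transpose (Q_mat m \<sigma>) *\<^sub>v \<beta>) ` region m (path_design0 m)"
proof -
  let ?Q = "inv_transpose (Q_mat m \<sigma>)"
  have move: "?Q *\<^sub>v \<gamma> \<in> region m (act_design m \<sigma> (path_design0 m)) \<longleftrightarrow> \<gamma> \<in> region m (path_design0 m)"
    if g: "\<gamma> \<in> carrier_vec (m - 1)" for \<gamma>
  proof -
    have "intensity m (?Q *\<^sub>v \<gamma>) (\<sigma> i) (\<sigma> j)
          * (\<Sum>k = i..<j. 1 / intensity m (?Q *\<^sub>v \<gamma>) (\<sigma> k) (\<sigma> (k + 1)))
        = intensity m \<gamma> i j * (\<Sum>k = i..<j. 1 / intensity m \<gamma> k (k + 1))"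
      if "1 \<le> i \<and> i < j \<and> j \<le> m" for i j
    proof -
      have "(\<Sum>k = i..<j. 1 / intensity m (?Q *\<^sub>v \<gamma>) (\<sigma> k) (\<sigma> (k + 1)))
          = (\<Sum>k = i..<j. 1 / intensity m \<gamma> k (k + 1))"
        using that by (intro sum.cong refl) (subst intensity_inv_transpose[OF s g], auto)
      moreover have "intensity m (?Q *\<^sub>v \<gamma>) (\<sigma> i) (\<sigma> j) = intensity m \<gamma> i j"
        using that by (intro intensity_inv_transpose[OF s g]) auto
      ultimately show ?thesis by simp
    qed
    moreover have "?Q *\<^sub>v \<gamma> \<in> carrier_vec (m - 1)"
      by (rule inv_transpose_carrier[OF s g])
    ultimately show ?thesis
      using g unfolding region_path[OF s m] region_path0[OF m] by auto
  qed
  show ?thesis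
  proof (intro equalityI subsetI)
    fix \<beta> assume b: "\<beta> \<in> region m (act_design m \<sigma> (path_design0 m))"
    then have "\<beta> \<in> carrier_vec (m - 1)" by (simp add: region_def)
    then obtain \<gamma> where "\<gamma> \<in> carrier_vec (m - 1)" "\<beta> = ?Q *\<^sub>v \<gamma>"
      using inv_transpose_surj[OF s] by blast
    then show "\<beta> \<in> (\<lambda>\<beta>. ?Q *\<^sub>v \<beta>) ` region m (path_design0 m)"
      using b move by blast
  next
    fix \<beta> assume "\<beta> \<in> (\<lambda>\<beta>. ?Q *\<^sub>v \<beta>) ` region m (path_design0 m)"
    then obtain \<gamma> where g: "\<gamma> \<in> region m (path_design0 m)" "\<beta> = ?Q *\<^sub>v \<gamma>" by blast
    then have "\<gamma> \<in> carrier_vec (m - 1)" by (simp add: region_def)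
    then show "\<beta> \<in> region m (act_design m \<sigma> (path_design0 m))"
      using move g by blast
  qed
qed

theorem theorem11:
  fixes m :: nat
  assumes "m \<ge> 2"
  shows
    "{\<xi>. design m \<xi> \<and> saturated m \<xi> \<and> (\<exists>\<beta>\<in>carrier_vec (m - 1). locally_D_optimal m \<xi> \<beta>)}
       = {act_design m \<sigma> (path_design0 m) | \<sigma>. \<sigma> permutes {1..m}}
   \<and> {act_design m \<sigma> (path_design0 m) | \<sigma>. \<sigma> permutes {1..m}}
       = {uniform_on m E | E. path_on m E}
   \<and> {region m \<xi> | \<xi>. design m \<xi> \<and> saturated m \<xi> \<and>
         (\<exists>\<beta>\<in>carrier_vec (m - 1). locally_D_optimal m \<xi> \<beta>)}
       = {(\<lambda>\<beta>. inv_transpose (Q_mat m \<sigma>) *\<^sub>v \<beta>) ` region m (path_design0 m) | \<sigma>. \<sigma> permutes {1..m}}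
   \<and> (\<forall>\<sigma>. \<sigma> permutes {1..m} \<longrightarrow>
         region m (act_design m \<sigma> (path_design0 m))
           = (\<lambda>\<beta>. inv_transpose (Q_mat m \<sigma>) *\<^sub>v \<beta>) ` region m (path_design0 m))
   \<and> (\<forall>\<sigma>. \<sigma> permutes {1..m} \<longrightarrow>
         supp m (act_design m \<sigma> (path_design0 m))
           = {act_pair \<sigma> (k, k + 1) | k. 1 \<le> k \<and> k < m} \<and>
         region m (act_design m \<sigma> (path_design0 m))
           = {\<beta> \<in> carrier_vec (m - 1). \<forall>i j. 1 \<le> i \<and> i < j \<and> j \<le> m \<longrightarrow>
                intensity m \<beta> (\<sigma> i) (\<sigma> j)
                  * (\<Sum>k = i..<j. 1 / intensity m \<beta> (\<sigma> k) (\<sigma> (k + 1))) \<le> 1})"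
    (is "?Opt = ?Orbit \<and> ?Orbit = ?Paths \<and> ?Reg = ?RegOrbit \<and> _ \<and> _")
proof (intro conjI allI impI)
  show opt: "?Opt = ?Orbit"
  proof (intro equalityI subsetI)
    fix \<xi> assume "\<xi> \<in> ?Opt"
    then obtain \<beta> where "saturated m \<xi>" "locally_D_optimal m \<xi> \<beta>" by blast
    then obtain \<sigma> where s: "\<sigma> permutes {1..m}" and "\<xi> = uniform_on m (path_edges m \<sigma>)"
      using saturated_optimal_imp_path[OF assms] by blast
    then have "\<xi> = act_design m \<sigma> (path_design0 m)" by (simp only: act_design_path)
    with s show "\<xi> \<in> ?Orbit" by blast
  next
    fix \<xi> assume "\<xi> \<in> ?Orbit"
    then obtain \<sigma> where s: "\<sigma> permutes {1..m}" and "\<xi> = act_design m \<sigma> (path_design0 m)"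
      by blast
    then have "\<xi> = uniform_on m (path_edges m \<sigma>)" by (simp only: act_design_path)
    then show "\<xi> \<in> ?Opt"
      using path_design[OF s assms] path_design_optimal_somewhere[OF s assms] by blast
  qed
  show "?Orbit = ?Paths"
  proof (intro equalityI subsetI)
    fix \<xi> assume "\<xi> \<in> ?Orbit"
    then obtain \<sigma> where s: "\<sigma> permutes {1..m}" and "\<xi> = act_design m \<sigma> (path_design0 m)"
      by blast
    then have "\<xi> = uniform_on m (path_edges m \<sigma>)" by (simp only: act_design_path)
    then show "\<xi> \<in> ?Paths" using path_on_path_edges[OF s] by blast
  next
    fix \<xi> assume "\<xi> \<in> ?Paths"
    then obtain E where E: "path_on m E" "\<xi> = uniform_on m E" by blast
    have "1 \<le> m" using assms by simp
    then obtain \<sigma> where s: "\<sigma> permutes {1..m}" "E = path_edges m \<sigma>"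
      using path_on_imp_path_edges[OF E(1)] by blast
    then have "\<xi> = act_design m \<sigma> (path_design0 m)" by (simp only: act_design_path E(2))
    then show "\<xi> \<in> ?Orbit" using s(1) by blast
  qed
  have "?Reg = region m ` ?Opt" by blast
  also have "\<dots> = ?RegOrbit" unfolding opt using region_orbit[OF _ assms] by blast
  finally show "?Reg = ?RegOrbit" .
next
  fix \<sigma> assume s: "\<sigma> permutes {1..m}"
  show "region m (act_design m \<sigma> (path_design0 m))
    = (\<lambda>\<beta>. inv_transpose (Q_mat m \<sigma>) *\<^sub>v \<beta>) ` region m (path_design0 m)"
    by (rule region_orbit[OF s assms])
  show "supp m (act_design m \<sigma> (path_design0 m)) = {act_pair \<sigma> (k, k + 1) | k. 1 \<le> k \<and> k < m}"
    unfolding act_design_path[OF s] path_design(2)[OF s assms] unfolding path_edges_def ..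
qed (rule region_path[OF _ assms])

end
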